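(* Let $\mathcal S=\{\phi_e\}_{e\in E}$ be a finitely irreducible conformal GDMS (graph directed Markov system) in $\mathbb R^n$ such that $J_{\mathcal S}$ is not porous, or $J_{\mathcal S}$ is not porous at some $\zeta\in\overline{J_{\mathcal S}}$. Then $J_{\mathcal S}$ is not porous at $m_h$-a.e. $x\in J_{\mathcal S}$, where $h=\dim_{\mathcal H}(J_{\mathcal S})$ and $m_h$ is the $h$-conformal measure of $\mathcal S$.
   Context: A GDMS $\mathcal S=\{V,E,A,t,i,\{X_v\}_{v\in V},\{\phi_e\}_{e\in E}\}$, abbreviated $\{\phi_e\}_{e\in E}$, consists of: a directed multigraph with a countable (finite or infinite) set of edges $E$ (the alphabet, having at least two elements) and a finite set of vertices $V$; an incidence matrix $A:E\times E\to\{0,1\}$; maps $i,t:E\to V$ with $t(a)=i(b)$ whenever $A_{ab}=1$; non-empty compact metric spaces $X_v$; injective contractions $\phi_e:X_{t(e)}\to X_{i(e)}$, all with Lipschitz constant at most a common $s\in(0,1)$. For every $v\in V$ there are $e,e'\in E$ with $t(e)=v$, $i(e')=v$. $E_A^n$ is the set of words $\omega=\omega_1\ldots\omega_n$ with $A_{\omega_k\omega_{k+1}}=1$ for all $k<n$; $E_A^*=\bigcup_{n\ge0}E_A^n$; $E_A^{\mathbb N}$ is the set of infinite admissible words, with the topology inherited from the product of discrete spaces; $\omega|_n=\omega_1\ldots\omega_n$. For $\omega\in E_A^n$, $n\ge1$, $\phi_\omega=\phi_{\omega_1}\circ\cdots\circ\phi_{\omega_n}:X_{t(\omega)}\to X_{i(\omega)}$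 with $t(\omega)=t(\omega_n)$, $i(\omega)=i(\omega_1)$. $\mathcal S$ is finitely irreducible if there is a finite $\Lambda\subset E_A^*$ such that for all $a,b\in E$ there is $\omega\in\Lambda$ with $a\omega b\in E_A^*$. $X=\bigcup_{v}X_v$ (disjoint union), $\pi(\omega)$ is the unique point of $\bigcap_n\phi_{\omega|_n}(X_{t(\omega_n)})$ for $\omega\in E_A^{\mathbb N}$, and $J_{\mathcal S}=\pi(E_A^{\mathbb N})$ is the limit set. The GDMS is conformal if (1) each $X_v$ is a compact connected subset of a fixed $\mathbb R^n$ with $X_v=\overline{\operatorname{Int}X_v}$; (2) (open set condition) $\phi_a(\operatorname{Int}X_{t(a)})\cap\phi_b(\operatorname{Int}X_{t(b)})=\emptyset$ for $a\ne b$ in $E$; (3) for each $v$ there is an open connected $W_v\supset X_v$ such that each $\phi_e$ with $t(e)=v$ extends to a $C^1$ conformal diffeomorphism of $W_v$ into $W_{i(e)}$ (conformal: the derivative at each point is a similarity). Standing assumptions: compact sets $S_v$ with $X_v\subset\operatorname{Int}S_v\subset S_v\subset W_v$ are fixed, pairwise disjoint; and bounded distortion holds: there are $\alpha>0$, $K\ge1$ with $\big|\|D\phi_\omega(p)\|/\|D\phi_\omega(q)\|-1\big|\le K|p-q|^\alpha$ and $K^{-1}\le\|D\phi_\omega(p)\|/\|D\phi_\omega(q)\|\le K$ for all $\omega\in E_A^*$, $p,q\in S_{t(\omega)}$. Write $\|D\phi_\omega\|_\infty=\sup_{S_{t(\omega)}}\|D\phi_\omega\|$. Conformal measure: the topological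 pressure is $P(t)=\lim_{n\to\infty}\frac1n\log\sum_{\omega\in E_A^n}\|D\phi_\omega\|_\infty^t$, $t\ge0$; it is known that $\dim_{\mathcal H}(J_{\mathcal S})=\inf\{t\ge0:P(t)\le0\}=:h$, and that $\sum_{e\in E}\|D\phi_e\|_\infty^h<\infty$. For $t\ge0$ with $\sum_{e\in E}\|D\phi_e\|_\infty^t<\infty$, the Perron–Frobenius operator on bounded continuous functions $g$ on $E_A^{\mathbb N}$ is $\mathcal L_tg(\omega)=\sum_{e:A_{e\omega_1}=1}g(e\omega)\|D\phi_e(\pi(\omega))\|^t$. There is a unique Borel probability measure $\tilde m_t$ on $E_A^{\mathbb N}$ that is an eigenmeasure of the dual operator $\mathcal L_t^*$, with eigenvalue $e^{P(t)}$; put $m_t=\tilde m_t\circ\pi^{-1}$. The $h$-conformal measure is $m_h$. Porosity (in $\mathbb R^n$): for a bounded $G\subset\mathbb R^n$, $x\in\mathbb R^n$, $r>0$, $\operatorname{por}(G,x,r)=\sup\{c\ge0: B(y,cr)\subset B(x,r)\setminus G\text{ for some }y\in\mathbb R^n\}$. $G$ is porous at $x$ if there are $c\in(0,1)$, $r_0>0$ with $\operatorname{por}(G,x,r)\ge c$ for all $r\in(0,r_0)$; $G$ is porous if there are $c\in(0,1)$, $r_0>0$ with $\operatorname{por}(G,x,r)\ge c$ for all $x\in G$ and $r\in(0,r_0)$. *)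

theory Defs
  imports "HOL-Probability.Probability"
begin

section \<open>Hausdorff dimension\<close>

definition hausdorff_pre :: "real \<Rightarrow> real \<Rightarrow> 'a::metric_space set \<Rightarrow> ennreal" where
  "hausdorff_pre \<delta> s A =
     (INF U \<in> {U :: nat \<Rightarrow> 'a set. A \<subseteq> (\<Union>k. U k) \<and> (\<forall>k. bounded (U k) \<and> diameter (U k) \<le> \<delta>)}.
        \<Sum>k. ennreal (diameter (U k) powr s))"

definition hausdorff_outer_measure :: "real \<Rightarrow> 'a::metric_space set \<Rightarrow> ennreal" where
  "hausdorff_outer_measure s A = (SUP \<delta>\<in>{0<..}. hausdorff_pre \<delta> s A)"

text \<open>Only exponents \<open>s > 0\<close> are used, which avoids any convention for \<open>0\<close> to the power \<open>0\<close> and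
  does not change the infimum. In a Euclidean space the set below is non-empty (it contains every
  \<open>s\<close> above the dimension of the space), so the real-valued infimum is the usual one.\<close>

definition hausdorff_dim :: "'a::euclidean_space set \<Rightarrow> real" where
  "hausdorff_dim A = Inf {s. 0 < s \<and> hausdorff_outer_measure s A = 0}"


section \<open>Porosity\<close>

text \<open>With open balls \<open>c = 0\<close> always qualifies, so the supremum is over a non-empty bounded set
  for every \<open>r > 0\<close>.\<close>

definition por :: "'a::euclidean_space set \<Rightarrow> 'a \<Rightarrow> real \<Rightarrow> real" where
  "por G x r = Sup {c. 0 \<le> c \<and> (\<exists>y. ball y (c * r) \<subseteq> ball x r - G)}"

definition porous_at :: "'a::euclidean_space set \<Rightarrow> 'a \<Rightarrow> bool" where
  "porous_at G x \<longleftrightarrow> (\<exists>c r0. 0 < c \<and> c < 1 \<and> 0 < r0 \<and> (\<forall>r. 0 < r \<and> r < r0 \<longrightarrow> c \<le> por G x r))"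

definition porous :: "'a::euclidean_space set \<Rightarrow> bool" where
  "porous G \<longleftrightarrow>
     (\<exists>c r0. 0 < c \<and> c < 1 \<and> 0 < r0 \<and> (\<forall>x\<in>G. \<forall>r. 0 < r \<and> r < r0 \<longrightarrow> c \<le> por G x r))"


section \<open>Graph directed Markov systems\<close>

text \<open>All pieces \<open>X\<^sub>v\<close> are subsets of one ambient type. \<open>gmap S e\<close> is a total function, of which only
  the restriction to \<open>piece S (ter S e)\<close> (in the conformal case: to \<open>nbhd S (ter S e)\<close>) matters.\<close>

record ('v, 'e, 'a) gdms_data =
  verts :: "'v set"
  edges :: "'e set"
  incid :: "'e \<Rightarrow> 'e \<Rightarrow> bool"
  ter :: "'e \<Rightarrow> 'v"
  ini :: "'e \<Rightarrow> 'v"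
  piece :: "'v \<Rightarrow> 'a set"
  gmap :: "'e \<Rightarrow> 'a \<Rightarrow> 'a"

locale gdms =
  fixes S :: "('v, 'e, 'a::metric_space, 'z) gdms_data_scheme"
  assumes finite_verts: "finite (verts S)"
    and countable_edges: "countable (edges S)"
    and two_edges: "\<exists>a\<in>edges S. \<exists>b\<in>edges S. a \<noteq> b"
    and ini_verts: "\<And>e. e \<in> edges S \<Longrightarrow> ini S e \<in> verts S"
    and ter_verts: "\<And>e. e \<in> edges S \<Longrightarrow> ter S e \<in> verts S"
    and incid_vertex: "\<And>a b. a \<in> edges S \<Longrightarrow> b \<in> edges S \<Longrightarrow> incid S a b \<Longrightarrow> ter S a = ini S b"
    and edge_into: "\<And>v. v \<in> verts S \<Longrightarrow> \<exists>e\<in>edges S. ter S e = v"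
    and edge_out: "\<And>v. v \<in> verts S \<Longrightarrow> \<exists>e\<in>edges S. ini S e = v"
    and piece_nonempty: "\<And>v. v \<in> verts S \<Longrightarrow> piece S v \<noteq> {}"
    and piece_compact: "\<And>v. v \<in> verts S \<Longrightarrow> compact (piece S v)"
    and gmap_into: "\<And>e. e \<in> edges S \<Longrightarrow> gmap S e ` piece S (ter S e) \<subseteq> piece S (ini S e)"
    and gmap_inj: "\<And>e. e \<in> edges S \<Longrightarrow> inj_on (gmap S e) (piece S (ter S e))"
    and gmap_contraction: "\<exists>s. 0 < s \<and> s < 1 \<and>
          (\<forall>e\<in>edges S. \<forall>x\<in>piece S (ter S e). \<forall>y\<in>piece S (ter S e).
             dist (gmap S e x) (gmap S e y) \<le> s * dist x y)"

definition fin_words :: "('v, 'e, 'a, 'z) gdms_data_scheme \<Rightarrow> 'e list set" where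
  "fin_words S = {w. set w \<subseteq> edges S \<and> successively (incid S) w}"

definition fin_words_of_length :: "('v, 'e, 'a, 'z) gdms_data_scheme \<Rightarrow> nat \<Rightarrow> 'e list set" where
  "fin_words_of_length S n = {w \<in> fin_words S. length w = n}"

text \<open>Infinite words are indexed from \<open>0\<close>: the letter \<open>\<omega>\<^sub>1\<close> is \<open>\<omega> 0\<close>.\<close>

definition inf_words :: "('v, 'e, 'a, 'z) gdms_data_scheme \<Rightarrow> (nat \<Rightarrow> 'e) set" where
  "inf_words S = {\<omega>. \<forall>k. \<omega> k \<in> edges S \<and> incid S (\<omega> k) (\<omega> (Suc k))}"

definition word_topology :: "('v, 'e, 'a, 'z) gdms_data_scheme \<Rightarrow> (nat \<Rightarrow> 'e) topology" where
  "word_topology S =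
     subtopology (product_topology (\<lambda>_. discrete_topology (edges S)) UNIV) (inf_words S)"

definition finitely_irreducible :: "('v, 'e, 'a, 'z) gdms_data_scheme \<Rightarrow> bool" where
  "finitely_irreducible S \<longleftrightarrow>
     (\<exists>\<Lambda>. finite \<Lambda> \<and> \<Lambda> \<subseteq> fin_words S \<and>
        (\<forall>a\<in>edges S. \<forall>b\<in>edges S. \<exists>w\<in>\<Lambda>. [a] @ w @ [b] \<in> fin_words S))"

text \<open>For a non-empty word \<open>w\<close>: \<open>i(w) = ini S (hd w)\<close> and \<open>t(w) = ter S (last w)\<close>.\<close>

definition word_map :: "('v, 'e, 'a, 'z) gdms_data_scheme \<Rightarrow> 'e list \<Rightarrow> 'a \<Rightarrow> 'a" where
  "word_map S w = foldr (\<lambda>e f. gmap S e \<circ> f) w id"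

definition coding :: "('v, 'e, 'a, 'z) gdms_data_scheme \<Rightarrow> (nat \<Rightarrow> 'e) \<Rightarrow> 'a" where
  "coding S \<omega> =
     (THE x. x \<in> (\<Inter>n\<in>{1..}. word_map S (map \<omega> [0..<n]) ` piece S (ter S (\<omega> (n - 1)))))"

definition limit_set :: "('v, 'e, 'a, 'z) gdms_data_scheme \<Rightarrow> 'a set" where
  "limit_set S = coding S ` inf_words S"


section \<open>Conformal systems\<close>

definition C1_conformal_diffeo_into ::
    "'a::euclidean_space set \<Rightarrow> 'a set \<Rightarrow> ('a \<Rightarrow> 'a) \<Rightarrow> bool" where
  "C1_conformal_diffeo_into W W' f \<longleftrightarrow>
     f ` W \<subseteq> W' \<and> inj_on f W \<and>
     (\<exists>f' :: 'a \<Rightarrow> 'a \<Rightarrow>\<^sub>L 'a.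
        (\<forall>p\<in>W. (f has_derivative blinfun_apply (f' p)) (at p)) \<and>
        continuous_on W f' \<and>
        (\<forall>p\<in>W. \<exists>c>0. \<forall>v. norm (blinfun_apply (f' p) v) = c * norm v))"

definition deriv_norm :: "('a::euclidean_space \<Rightarrow> 'a) \<Rightarrow> 'a \<Rightarrow> real" where
  "deriv_norm f p = onorm (frechet_derivative f (at p))"

text \<open>The open sets \<open>W\<^sub>v\<close> and the compact sets \<open>S\<^sub>v\<close> are part of the data, and \<open>gmap S e\<close> denotes the
  extended map on \<open>nbhd S (ter S e)\<close>.\<close>

record ('v, 'e, 'a) conformal_gdms_data = "('v, 'e, 'a) gdms_data" +
  nbhd :: "'v \<Rightarrow> 'a set"
  core :: "'v \<Rightarrow> 'a set"

locale conformal_gdms = gdms S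
  for S :: "('v, 'e, 'a::euclidean_space, 'z) conformal_gdms_data_scheme" +
  assumes piece_connected: "\<And>v. v \<in> verts S \<Longrightarrow> connected (piece S v)"
    and piece_regular: "\<And>v. v \<in> verts S \<Longrightarrow> piece S v = closure (interior (piece S v))"
    and open_set_condition: "\<And>a b. a \<in> edges S \<Longrightarrow> b \<in> edges S \<Longrightarrow> a \<noteq> b \<Longrightarrow>
          gmap S a ` interior (piece S (ter S a)) \<inter> gmap S b ` interior (piece S (ter S b)) = {}"
    and nbhd_open: "\<And>v. v \<in> verts S \<Longrightarrow> open (nbhd S v)"
    and nbhd_connected: "\<And>v. v \<in> verts S \<Longrightarrow> connected (nbhd S v)"
    and piece_nbhd: "\<And>v. v \<in> verts S \<Longrightarrow> piece S v \<subseteq> nbhd S v"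
    and gmap_conformal: "\<And>e. e \<in> edges S \<Longrightarrow>
          C1_conformal_diffeo_into (nbhd S (ter S e)) (nbhd S (ini S e)) (gmap S e)"
    and core_compact: "\<And>v. v \<in> verts S \<Longrightarrow> compact (core S v)"
    and piece_core: "\<And>v. v \<in> verts S \<Longrightarrow> piece S v \<subseteq> interior (core S v)"
    and core_nbhd: "\<And>v. v \<in> verts S \<Longrightarrow> core S v \<subseteq> nbhd S v"
    and core_disjoint: "\<And>v w. v \<in> verts S \<Longrightarrow> w \<in> verts S \<Longrightarrow> v \<noteq> w \<Longrightarrow> core S v \<inter> core S w = {}"
    and bounded_distortion: "\<exists>\<alpha> K. 0 < \<alpha> \<and> 1 \<le> K \<and>
          (\<forall>w\<in>fin_words S. w \<noteq> [] \<longrightarrow>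
             (\<forall>p\<in>core S (ter S (last w)). \<forall>q\<in>core S (ter S (last w)).
                \<bar>deriv_norm (word_map S w) p / deriv_norm (word_map S w) q - 1\<bar>
                  \<le> K * dist p q powr \<alpha> \<and>
                inverse K \<le> deriv_norm (word_map S w) p / deriv_norm (word_map S w) q \<and>
                deriv_norm (word_map S w) p / deriv_norm (word_map S w) q \<le> K))"

definition sup_deriv ::
    "('v, 'e, 'a::euclidean_space, 'z) conformal_gdms_data_scheme \<Rightarrow> 'e list \<Rightarrow> real" where
  "sup_deriv S w = (SUP p\<in>core S (ter S (last w)). deriv_norm (word_map S w) p)"


section \<open>Pressure and conformal measures\<close>

definition ln_ennreal :: "ennreal \<Rightarrow> ereal" where
  "ln_ennreal x = (if x = 0 then -\<infinity> else if x = \<infinity> then \<infinity> else ereal (ln (enn2real x)))"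

definition partition_sum ::
    "('v, 'e, 'a::euclidean_space, 'z) conformal_gdms_data_scheme \<Rightarrow> real \<Rightarrow> nat \<Rightarrow> ennreal" where
  "partition_sum S t n = (\<Sum>\<^sub>\<infinity>w\<in>fin_words_of_length S n. ennreal (sup_deriv S w powr t))"

definition pressure ::
    "('v, 'e, 'a::euclidean_space, 'z) conformal_gdms_data_scheme \<Rightarrow> real \<Rightarrow> ereal" where
  "pressure S t = lim (\<lambda>n. ln_ennreal (partition_sum S t n) / ereal (real n))"

definition summable_exponent ::
    "('v, 'e, 'a::euclidean_space, 'z) conformal_gdms_data_scheme \<Rightarrow> real \<Rightarrow> bool" where
  "summable_exponent S t \<longleftrightarrow> 0 \<le> t \<and> (\<lambda>e. sup_deriv S [e] powr t) summable_on edges S"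

text \<open>\<open>case_nat e \<omega>\<close> is the concatenation \<open>e\<omega>\<close>.\<close>

definition transfer_op ::
    "('v, 'e, 'a::euclidean_space, 'z) conformal_gdms_data_scheme \<Rightarrow> real \<Rightarrow>
       ((nat \<Rightarrow> 'e) \<Rightarrow> real) \<Rightarrow> (nat \<Rightarrow> 'e) \<Rightarrow> real" where
  "transfer_op S t g \<omega> =
     (\<Sum>\<^sub>\<infinity>e\<in>{e \<in> edges S. incid S e (\<omega> 0)}.
        g (case_nat e \<omega>) * deriv_norm (gmap S e) (coding S \<omega>) powr t)"

definition word_borel :: "('v, 'e, 'a, 'z) gdms_data_scheme \<Rightarrow> (nat \<Rightarrow> 'e) measure" where
  "word_borel S = sigma (inf_words S) {U. openin (word_topology S) U}"

text \<open>Borel probability measures on the space of infinite words which are eigenmeasures of the dual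
  Perron--Frobenius operator with eigenvalue \<open>exp P(t)\<close>. The operator is only defined for
  summable exponents; for these the pressure is finite (under finite irreducibility).\<close>

definition eigenmeasure ::
    "('v, 'e, 'a::euclidean_space, 'z) conformal_gdms_data_scheme \<Rightarrow> real \<Rightarrow>
       (nat \<Rightarrow> 'e) measure \<Rightarrow> bool" where
  "eigenmeasure S t M \<longleftrightarrow>
     summable_exponent S t \<and> prob_space M \<and>
     space M = inf_words S \<and> sets M = sets (word_borel S) \<and>
     (\<forall>g. continuous_map (word_topology S) euclideanreal g \<and> bounded (g ` inf_words S) \<longrightarrow>
        (\<integral>\<omega>. transfer_op S t g \<omega> \<partial>M) = exp (real_of_ereal (pressure S t)) * (\<integral>\<omega>. g \<omega> \<partial>M))"

definition conformal_measure ::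
    "('v, 'e, 'a::euclidean_space, 'z) conformal_gdms_data_scheme \<Rightarrow> real \<Rightarrow> 'a measure \<Rightarrow> bool" where
  "conformal_measure S t m \<longleftrightarrow> (\<exists>M. eigenmeasure S t M \<and> m = distr M borel (coding S))"

end

theory Submission
  imports Defs
begin

text \<open>If the limit set is not porous, then
  neither is one of finitely many subsets \<open>J\<^sub>a\<close>, coded by the words that may follow a letter \<open>a\<close>; here finite
  irreducibility and the stability of uniform porosity under finite unions are used. So for every \<open>\<epsilon>\<close>
  there is a ball with centre in \<open>J\<^sub>a\<close>, of small radius, in which \<open>J\<^sub>a\<close> is \<open>\<epsilon>\<close>-dense relative to the radius.
  A long prefix \<open>v\<close> of a word coding the centre pins this ball down: whenever \<open>a v\<close> occurs in an infinite
  word, the map of the part up to and including \<open>a\<close> transports the dense ball, with bounded distortion,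
  to a neighbourhood of the coded point. By bounded distortion the eigenmeasure satisfies
  \<open>m[uv] \<ge> C m[u] m[v]\<close> on cylinders, which with finite irreducibility forces every admissible
  finite word to occur in almost every infinite word.\<close>

section \<open>Porosity\<close>

text \<open>In \<open>uniformly_porous\<close> the centre ranges over the whole space. Its negation
  follows from either alternative of the hypothesis, and a free centre lets holes be searched inside
  holes, which gives stability under unions.

  Three obstacles shape the rest. The map of a word \<open>u\<close> carries into the limit set only
  points coded by words that may follow \<open>last u\<close>, so density of the whole limit set in
  a ball cannot be transported; density of the part following one fixed letter can. Distortion is
  controlled only on the sets \<open>core\<close>, and mean value estimates need convexity, so
  everything happens in balls inside one core. Finally, an infinite alphabet has no positive lower
  bound for the measures of its letters; finite irreducibility restores one, because finitely many
  linking words suffice to reach a given word from any letter.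

  The density constant must survive transport: one factor \<open>distortion\<close> is lost because
  the image of a ball contains only a smaller ball, another because distances may be stretched. This
  is the origin of the square of \<open>distortion\<close> in the geometric estimates.\<close>

definition uniformly_porous :: "'a::metric_space set \<Rightarrow> bool" where
  "uniformly_porous G \<longleftrightarrow>
     (\<exists>c>0. \<exists>r0>0. \<forall>x r. 0 < r \<and> r < r0 \<longrightarrow> (\<exists>y. ball y (c * r) \<subseteq> ball x r - G))"

text \<open>The supremum need not be attained, so a hole is available only for constants strictly
  below it. This is why \<open>porous_at_iff\<close> halves the constant.\<close>

lemma less_por_imp_ball:
  assumes "c < por G x r"
  obtains c' y where "c < c'" "ball y (c' * r) \<subseteq> ball x r - G"
proof -
  have "0 \<in> {c. 0 \<le> c \<and> (\<exists>y. ball y (c * r) \<subseteq> ball x r - G)}"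
    by simp
  then show ?thesis
    using less_cSupD[of "{c. 0 \<le> c \<and> (\<exists>y. ball y (c * r) \<subseteq> ball x r - G)}" c] assms that
    unfolding por_def by blast
qed

text \<open>A real \<open>Sup\<close> says something only for a set bounded above. Here
  \<open>1\<close> is a bound, since a ball contained in \<open>ball x r\<close> has radius at most
  \<open>r\<close>.\<close>

lemma le_por:
  fixes G :: "'a::euclidean_space set"
  assumes "0 \<le> c" "0 < r" "ball y (c * r) \<subseteq> ball x r - G"
  shows "c \<le> por G x r"
  unfolding por_def
proof (rule cSup_upper)
  show "bdd_above {c. 0 \<le> c \<and> (\<exists>y. ball y (c * r) \<subseteq> ball x r - G)}"
  proof (rule bdd_aboveI)
    fix d assume "d \<in> {c. 0 \<le> c \<and> (\<exists>y. ball y (c * r) \<subseteq> ball x r - G)}"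
    then obtain z where d: "0 \<le> d" and "ball z (d * r) \<subseteq> ball x r"
      by blast
    then consider "dist z x + d * r \<le> r" | "d * r \<le> 0"
      unfolding ball_subset_ball_iff by blast
    then show "d \<le> 1"
    proof cases
      case 1
      then have "d * r \<le> 1 * r"
        using zero_le_dist[of z x] by linarith
      then show ?thesis
        using assms(2) mult_le_cancel_right_pos by blast
    next
      case 2
      then show ?thesis
        using assms(2) d by (simp add: mult_le_0_iff)
    qed
  qed
qed (use assms in blast)

text \<open>The definitions of porosity demand a constant below \<open>1\<close>; cutting at
  \<open>1 / 2\<close> provides it.\<close>

lemma min_half_le_por:
  fixes G :: "'a::euclidean_space set"
  assumes "0 < c" "0 < r" "ball y (c * r) \<subseteq> ball x r - G"
  shows "min c (1 / 2) \<le> por G x r"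
proof -
  have "min c (1 / 2) * r \<le> c * r"
    using assms(2) by (simp add: mult_right_mono)
  then have "ball y (min c (1 / 2) * r) \<subseteq> ball x r - G"
    using assms(3) subset_ball by blast
  then show ?thesis
    using le_por[of "min c (1 / 2)"] assms by simp
qed

lemma porous_at_iff:
  fixes G :: "'a::euclidean_space set"
  shows "porous_at G x \<longleftrightarrow>
    (\<exists>c>0. \<exists>r0>0. \<forall>r. 0 < r \<and> r < r0 \<longrightarrow> (\<exists>y. ball y (c * r) \<subseteq> ball x r - G))"
proof
  assume "porous_at G x"
  then obtain c r0 where c: "0 < c" "0 < r0" and p: "\<And>r. 0 < r \<Longrightarrow> r < r0 \<Longrightarrow> c \<le> por G x r"
    unfolding porous_at_def by blast
  have "\<exists>y. ball y (c / 2 * r) \<subseteq> ball x r - G" if r: "0 < r" "r < r0" for r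
  proof -
    have "c / 2 < por G x r"
      using p[OF r] c by linarith
    then obtain c' y where "c / 2 < c'" "ball y (c' * r) \<subseteq> ball x r - G"
      using less_por_imp_ball by blast
    moreover have "c / 2 * r \<le> c' * r"
      using \<open>c / 2 < c'\<close> r by (simp add: mult_right_mono)
    ultimately show ?thesis
      using subset_ball[of "c / 2 * r" "c' * r" y] by blast
  qed
  then show "\<exists>c>0. \<exists>r0>0. \<forall>r. 0 < r \<and> r < r0 \<longrightarrow> (\<exists>y. ball y (c * r) \<subseteq> ball x r - G)"
    using c by (intro exI[of _ "c / 2"] conjI exI[of _ r0]) auto
next
  assume "\<exists>c>0. \<exists>r0>0. \<forall>r. 0 < r \<and> r < r0 \<longrightarrow> (\<exists>y. ball y (c * r) \<subseteq> ball x r - G)"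
  then obtain c r0 where c: "0 < c" "0 < r0"
    and b: "\<And>r. 0 < r \<Longrightarrow> r < r0 \<Longrightarrow> \<exists>y. ball y (c * r) \<subseteq> ball x r - G"
    by blast
  have "min c (1 / 2) \<le> por G x r" if "0 < r" "r < r0" for r
    using b[OF that] min_half_le_por c that by blast
  then show "porous_at G x"
    unfolding porous_at_def using c
    by (intro exI[of _ "min c (1 / 2)"] exI[of _ r0]) auto
qed

lemma porous_if_uniformly_porous:
  fixes G :: "'a::euclidean_space set"
  assumes "uniformly_porous G"
  shows "porous G"
proof -
  obtain c r0 where c: "0 < c" "0 < r0"
    and b: "\<And>x r. 0 < r \<Longrightarrow> r < r0 \<Longrightarrow> \<exists>y. ball y (c * r) \<subseteq> ball x r - G"
    using assms unfolding uniformly_porous_def by blast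
  have "min c (1 / 2) \<le> por G x r" if "0 < r" "r < r0" for x r
    using b[OF that] min_half_le_por c that by blast
  then show "porous G"
    unfolding porous_def using c
    by (intro exI[of _ "min c (1 / 2)"] exI[of _ r0]) auto
qed

lemma porous_at_if_uniformly_porous:
  fixes G :: "'a::euclidean_space set"
  assumes "uniformly_porous G"
  shows "porous_at G x"
  using assms unfolding uniformly_porous_def porous_at_iff by meson

text \<open>Inside the hole of relative size \<open>c\<close> found for \<open>G\<close>, the
  porosity of \<open>H\<close> gives a hole of relative size \<open>d\<close>, hence the constant
  \<open>d * c\<close>. The centre of the first hole need not be near \<open>H\<close>, so arbitrary
  centres are essential for this argument. The bound \<open>r1 / c\<close> keeps the inner radius
  \<open>c * r\<close> below \<open>r1\<close>.\<close>

lemma uniformly_porous_Un: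
  assumes "uniformly_porous G" "uniformly_porous H"
  shows "uniformly_porous (G \<union> H)"
proof -
  obtain c r0 where c: "0 < c" "0 < r0"
    and b: "\<And>x r. 0 < r \<Longrightarrow> r < r0 \<Longrightarrow> \<exists>y. ball y (c * r) \<subseteq> ball x r - G"
    using assms(1) unfolding uniformly_porous_def by blast
  obtain d r1 where d: "0 < d" "0 < r1"
    and e: "\<And>x r. 0 < r \<Longrightarrow> r < r1 \<Longrightarrow> \<exists>y. ball y (d * r) \<subseteq> ball x r - H"
    using assms(2) unfolding uniformly_porous_def by blast
  have "\<exists>y. ball y ((d * c) * r) \<subseteq> ball x r - (G \<union> H)"
    if r: "0 < r" "r < min r0 (r1 / c)" for x r
  proof -
    obtain y where y: "ball y (c * r) \<subseteq> ball x r - G"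
      using b[of r] r by auto
    have "0 < c * r" "c * r < r1"
      using r c by (auto simp: field_simps)
    then obtain z where "ball z (d * (c * r)) \<subseteq> ball y (c * r) - H"
      using e by meson
    then show ?thesis
      using y by (intro exI[of _ z]) (auto simp: mult.assoc)
  qed
  then show ?thesis
    unfolding uniformly_porous_def using c d
    by (intro exI[of _ "d * c"] conjI exI[of _ "min r0 (r1 / c)"]) auto
qed

lemma uniformly_porous_empty: "uniformly_porous ({} :: 'a::metric_space set)"
proof -
  have "ball x (1 * r) \<subseteq> ball x r - {}" for x :: 'a and r
    by simp
  then show ?thesis
    unfolding uniformly_porous_def using zero_less_one by blast
qed

lemma uniformly_porous_UN:
  assumes "finite I" "\<And>i. i \<in> I \<Longrightarrow> uniformly_porous (G i)"
  shows "uniformly_porous (\<Union>i\<in>I. G i)"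
  using assms
proof (induction I)
  case empty
  then show ?case
    by (simp add: uniformly_porous_empty)
next
  case (insert i I)
  then show ?case
    using uniformly_porous_Un[of "G i" "\<Union>i\<in>I. G i"] by simp
qed

section \<open>Measurability of the set of porosity points\<close>

text \<open>The centres \<open>y\<close> of the balls missing \<open>G\<close> form a closed set, and the set below is its sum
  with a compact ball.\<close>

lemma closed_ball_in_complement:
  fixes G :: "'a::euclidean_space set"
  assumes "0 < \<rho>"
  shows "closed {x. \<exists>y. ball y \<rho> \<subseteq> ball x r - G}"
proof -
  define Y where "Y = {y. ball y \<rho> \<inter> G = {}}"
  have "Y = - (\<Union>g\<in>G. ball g \<rho>)"
    unfolding Y_def by (auto simp: dist_commute)
  then have "closed Y"
    by (simp add: closed_open open_UN)
  then have "closed (\<Union>y\<in>Y. \<Union>z\<in>cball 0 (r - \<rho>). {y + z})"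
    by (intro closed_compact_sums compact_cball)
  moreover have "{x. \<exists>y. ball y \<rho> \<subseteq> ball x r - G} = (\<Union>y\<in>Y. \<Union>z\<in>cball 0 (r - \<rho>). {y + z})"
  proof (intro set_eqI iffI)
    fix x assume "x \<in> {x. \<exists>y. ball y \<rho> \<subseteq> ball x r - G}"
    then obtain y where y: "ball y \<rho> \<subseteq> ball x r" "y \<in> Y"
      unfolding Y_def by auto
    then have "x - y \<in> cball 0 (r - \<rho>)"
      using assms unfolding ball_subset_ball_iff by (auto simp: dist_norm norm_minus_commute)
    then show "x \<in> (\<Union>y\<in>Y. \<Union>z\<in>cball 0 (r - \<rho>). {y + z})"
      using y(2) by (intro UN_I[of y] UN_I[of "x - y"]) auto
  next
    fix x assume "x \<in> (\<Union>y\<in>Y. \<Union>z\<in>cball 0 (r - \<rho>). {y + z})"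
    then obtain y z where y: "y \<in> Y" "norm z \<le> r - \<rho>" "x = y + z"
      by auto
    then have "ball y \<rho> \<subseteq> ball x r"
      unfolding ball_subset_ball_iff by (simp add: dist_norm)
    then show "x \<in> {x. \<exists>y. ball y \<rho> \<subseteq> ball x r - G}"
      using y(1) unfolding Y_def by blast
  qed
  ultimately show ?thesis
    by simp
qed

text \<open>With \<open>1 / Suc k\<close> in the role of both the constant and the threshold, the
  set is a countable union of closed sets \<open>P k\<close>. The intersection over all radii is
  uncountable, which closedness tolerates.\<close>

lemma borel_porous_at: "{x. porous_at G x} \<in> sets borel"
  for G :: "'a::euclidean_space set"
proof -
  define P where "P k = (\<Inter>r\<in>{0<..<1 / Suc k}. {x. \<exists>y. ball y (1 / Suc k * r) \<subseteq> ball x r - G})"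
    for k :: nat
  have "{x. porous_at G x} = (\<Union>k. P k)"
  proof (intro set_eqI iffI)
    fix x assume "x \<in> {x. porous_at G x}"
    then obtain c r0 where c: "0 < c" "0 < r0"
      and b: "\<And>r. 0 < r \<Longrightarrow> r < r0 \<Longrightarrow> \<exists>y. ball y (c * r) \<subseteq> ball x r - G"
      unfolding porous_at_iff by blast
    obtain k where "inverse (real (Suc k)) < min c r0"
      using reals_Archimedean[of "min c r0"] c by auto
    then have k: "1 / Suc k < c" "1 / Suc k < r0"
      by (auto simp: inverse_eq_divide)
    have "\<exists>y. ball y (1 / Suc k * r) \<subseteq> ball x r - G" if r: "0 < r" "r < 1 / Suc k" for r
    proof -
      obtain y where "ball y (c * r) \<subseteq> ball x r - G"
        using b[of r] r k by auto
      moreover have "1 / Suc k * r \<le> c * r"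
        using r k by (intro mult_right_mono) auto
      ultimately show ?thesis
        using subset_ball[of "1 / Suc k * r" "c * r" y] by blast
    qed
    then have "x \<in> P k"
      unfolding P_def by simp
    then show "x \<in> (\<Union>k. P k)" by blast
  next
    fix x assume "x \<in> (\<Union>k. P k)"
    then obtain k where "x \<in> P k" by blast
    then show "x \<in> {x. porous_at G x}"
      unfolding P_def mem_Collect_eq porous_at_iff
      by (intro exI[of _ "1 / Suc k"] conjI) auto
  qed
  moreover have "closed (P k)" for k
    unfolding P_def by (intro closed_INT ballI closed_ball_in_complement) auto
  ultimately show ?thesis
    by auto
qed

section \<open>Coding in graph directed Markov systems\<close>

text \<open>Folding \<open>case_nat\<close> agrees with the way \<open>transfer_op\<close> puts a
  letter in front of a word.\<close>

definition prepend :: "'e list \<Rightarrow> (nat \<Rightarrow> 'e) \<Rightarrow> nat \<Rightarrow> 'e" where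
  "prepend u \<omega> = foldr case_nat u \<omega>"

definition suffix_from :: "nat \<Rightarrow> (nat \<Rightarrow> 'e) \<Rightarrow> nat \<Rightarrow> 'e" where
  "suffix_from n \<omega> = (\<lambda>k. \<omega> (n + k))"

lemma prepend_Nil [simp]: "prepend [] \<omega> = \<omega>"
  and prepend_Cons [simp]: "prepend (e # u) \<omega> = case_nat e (prepend u \<omega>)"
  by (simp_all add: prepend_def)

lemma prepend_nth: "prepend u \<omega> k = (if k < length u then u ! k else \<omega> (k - length u))"
  by (induction u arbitrary: k) (auto split: nat.split)

lemma prepend_suffix_from: "prepend (map \<omega> [0..<n]) (suffix_from n \<omega>) = \<omega>"
  by (rule ext) (simp add: prepend_nth suffix_from_def)

lemma word_map_Nil [simp]: "word_map S [] = id"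
  and word_map_Cons [simp]: "word_map S (e # u) = gmap S e \<circ> word_map S u"
  by (simp_all add: word_map_def)

lemma word_map_append: "word_map S (u @ v) = word_map S u \<circ> word_map S v"
  by (induction u) (simp_all add: comp_assoc)

lemma fin_words_append:
  "u @ v \<in> fin_words S \<longleftrightarrow> u \<in> fin_words S \<and> v \<in> fin_words S \<and>
     (u \<noteq> [] \<longrightarrow> v \<noteq> [] \<longrightarrow> incid S (last u) (hd v))"
  by (auto simp: fin_words_def successively_append_iff)

lemma fin_words_Cons:
  "e # u \<in> fin_words S \<longleftrightarrow> e \<in> edges S \<and> u \<in> fin_words S \<and> (u \<noteq> [] \<longrightarrow> incid S e (hd u))"
  by (cases u) (auto simp: fin_words_def)

lemma last_in_edges: "u \<in> fin_words S \<Longrightarrow> u \<noteq> [] \<Longrightarrow> last u \<in> edges S"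
  by (auto simp: fin_words_def)

lemma hd_in_edges: "u \<in> fin_words S \<Longrightarrow> u \<noteq> [] \<Longrightarrow> hd u \<in> edges S"
  by (auto simp: fin_words_def)

lemma inf_words_edge: "\<omega> \<in> inf_words S \<Longrightarrow> \<omega> k \<in> edges S"
  by (auto simp: inf_words_def)

lemma case_nat_in_inf_words:
  "case_nat e \<omega> \<in> inf_words S \<longleftrightarrow> e \<in> edges S \<and> incid S e (\<omega> 0) \<and> \<omega> \<in> inf_words S"
proof
  assume *: "case_nat e \<omega> \<in> inf_words S"
  have "\<omega> k \<in> edges S \<and> incid S (\<omega> k) (\<omega> (Suc k))" for k
    using * unfolding inf_words_def by (auto dest: spec[of _ "Suc k"])
  moreover have "e \<in> edges S \<and> incid S e (\<omega> 0)"
    using * unfolding inf_words_def by (auto dest: spec[of _ 0])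
  ultimately show "e \<in> edges S \<and> incid S e (\<omega> 0) \<and> \<omega> \<in> inf_words S"
    by (auto simp: inf_words_def)
qed (auto simp: inf_words_def split: nat.split)

lemma prepend_in_inf_words:
  assumes "u \<noteq> []"
  shows "prepend u \<omega> \<in> inf_words S \<longleftrightarrow>
           u \<in> fin_words S \<and> incid S (last u) (\<omega> 0) \<and> \<omega> \<in> inf_words S"
  using assms
proof (induction u)
  case (Cons e u)
  show ?case
  proof (cases "u = []")
    case True
    then show ?thesis
      by (auto simp: case_nat_in_inf_words fin_words_Cons fin_words_def)
  next
    case False
    then have "prepend u \<omega> 0 = hd u"
      by (simp add: prepend_nth hd_conv_nth)
    then show ?thesis
      using Cons.IH[OF False] False by (auto simp: case_nat_in_inf_words fin_words_Cons)
  qed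
qed simp

lemma suffix_from_in_inf_words: "\<omega> \<in> inf_words S \<Longrightarrow> suffix_from n \<omega> \<in> inf_words S"
  by (auto simp: inf_words_def suffix_from_def)

lemma prefix_in_fin_words:
  assumes "\<omega> \<in> inf_words S"
  shows "map \<omega> [m..<n] \<in> fin_words S"
  using assms
  by (auto simp: fin_words_def inf_words_def successively_conv_nth)

section \<open>Contraction of word maps and the coding map\<close>

context gdms
begin

lemma ter_eq_ini: "\<omega> \<in> inf_words S \<Longrightarrow> ter S (\<omega> k) = ini S (\<omega> (Suc k))"
  using incid_vertex unfolding inf_words_def by blast

lemma word_map_into_piece:
  assumes "u \<in> fin_words S" "u \<noteq> []"
  shows "word_map S u ` piece S (ter S (last u)) \<subseteq> piece S (ini S (hd u))"
  using assms
proof (induction u)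
  case (Cons e u)
  then show ?case
  proof (cases "u = []")
    case True
    then show ?thesis
      using Cons.prems gmap_into[of e] by (auto simp: fin_words_Cons)
  next
    case False
    then have "ter S e = ini S (hd u)" "e \<in> edges S"
      using Cons.prems False incid_vertex[of e "hd u"] hd_in_edges[of u S]
      by (auto simp: fin_words_Cons)
    then show ?thesis
      using Cons False gmap_into[of e] by (fastforce simp: fin_words_Cons image_subset_iff)
  qed
qed simp

definition contraction_ratio :: real where
  "contraction_ratio = (SOME s. 0 < s \<and> s < 1 \<and>
     (\<forall>e\<in>edges S. \<forall>x\<in>piece S (ter S e). \<forall>y\<in>piece S (ter S e).
        dist (gmap S e x) (gmap S e y) \<le> s * dist x y))"

lemma contraction_ratio: "0 < contraction_ratio" "contraction_ratio < 1"
  and dist_gmap_le: "e \<in> edges S \<Longrightarrow> x \<in> piece S (ter S e) \<Longrightarrow> y \<in> piece S (ter S e) \<Longrightarrow>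
    dist (gmap S e x) (gmap S e y) \<le> contraction_ratio * dist x y"
  using someI_ex[OF gmap_contraction] unfolding contraction_ratio_def[symmetric] by blast+

lemma dist_word_map_le:
  assumes "u \<in> fin_words S" "u \<noteq> []"
    and "x \<in> piece S (ter S (last u))" "y \<in> piece S (ter S (last u))"
  shows "dist (word_map S u x) (word_map S u y) \<le> contraction_ratio ^ length u * dist x y"
  using assms
proof (induction u)
  case (Cons e u)
  then show ?case
  proof (cases "u = []")
    case True
    then show ?thesis
      using Cons.prems dist_gmap_le[of e] by (auto simp: fin_words_Cons)
  next
    case False
    then have e: "ter S e = ini S (hd u)" "e \<in> edges S" and u: "u \<in> fin_words S"
      using Cons.prems False incid_vertex[of e "hd u"] hd_in_edges[of u S]
      by (auto simp: fin_words_Cons)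
    have xy: "x \<in> piece S (ter S (last u))" "y \<in> piece S (ter S (last u))"
      using Cons.prems False by auto
    then have "word_map S u x \<in> piece S (ter S e)" "word_map S u y \<in> piece S (ter S e)"
      using word_map_into_piece[OF u False] e by auto
    then have "dist (word_map S (e # u) x) (word_map S (e # u) y)
        \<le> contraction_ratio * dist (word_map S u x) (word_map S u y)"
      using dist_gmap_le e by simp
    also have "\<dots> \<le> contraction_ratio * (contraction_ratio ^ length u * dist x y)"
      using Cons.IH[OF u False xy] contraction_ratio(1) by (simp add: mult_left_mono)
    finally show ?thesis
      by (simp add: mult.assoc)
  qed
qed simp

lemma continuous_on_word_map:
  assumes "u \<in> fin_words S" "u \<noteq> []"
  shows "continuous_on (piece S (ter S (last u))) (word_map S u)"
proof (rule continuous_on_iff[THEN iffD2], intro ballI allI impI)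
  fix x and \<epsilon> :: real
  assume x: "x \<in> piece S (ter S (last u))" and e: "0 < \<epsilon>"
  have le1: "contraction_ratio ^ length u \<le> 1"
    using contraction_ratio by (simp add: power_le_one)
  have "dist (word_map S u y) (word_map S u x) < \<epsilon>"
    if "y \<in> piece S (ter S (last u))" "dist y x < \<epsilon>" for y
  proof -
    have "dist (word_map S u y) (word_map S u x) \<le> contraction_ratio ^ length u * dist y x"
      using dist_word_map_le[OF assms that(1) x] .
    also have "\<dots> \<le> 1 * dist y x"
      using le1 by (intro mult_right_mono) auto
    finally show ?thesis
      using that by simp
  qed
  then show "\<exists>d>0. \<forall>x'\<in>piece S (ter S (last u)). dist x' x < d \<longrightarrow>
      dist (word_map S u x') (word_map S u x) < \<epsilon>"
    using e by blast
qed

lemma pieces_diameter: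
  obtains \<Delta> where "0 < \<Delta>"
    "\<And>v x y. v \<in> verts S \<Longrightarrow> x \<in> piece S v \<Longrightarrow> y \<in> piece S v \<Longrightarrow> dist x y \<le> \<Delta>"
proof -
  have "bounded (\<Union>v\<in>verts S. piece S v)"
    using finite_verts piece_compact compact_imp_bounded by (intro bounded_UN) auto
  then obtain a B where B: "\<And>x. x \<in> (\<Union>v\<in>verts S. piece S v) \<Longrightarrow> dist a x \<le> B"
    unfolding bounded_def by blast
  show ?thesis
  proof
    show "0 < 2 * \<bar>B\<bar> + 1" by simp
    fix v x y assume "v \<in> verts S" "x \<in> piece S v" "y \<in> piece S v"
    then have "dist a x \<le> B" "dist a y \<le> B"
      using B by blast+
    then show "dist x y \<le> 2 * \<bar>B\<bar> + 1"
      using dist_triangle2[of x y a] by (simp add: dist_commute)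
  qed
qed

text \<open>This is the set intersected in \<open>coding\<close>. It is meaningful for
  \<open>n > 0\<close> only: for \<open>n = 0\<close> truncated subtraction gives the piece at
  \<open>ter S (\<omega> 0)\<close>, whereas the coded point lies in the piece at
  \<open>ini S (\<omega> 0)\<close>.\<close>

abbreviation cyl_image :: "(nat \<Rightarrow> 'e) \<Rightarrow> nat \<Rightarrow> 'a set" where
  "cyl_image \<omega> n \<equiv> word_map S (map \<omega> [0..<n]) ` piece S (ter S (\<omega> (n - 1)))"

lemma last_map_upt: "0 < n \<Longrightarrow> last (map \<omega> [0..<n]) = \<omega> (n - 1)"
  by (simp add: last_map)

lemma cyl_image_dist:
  assumes "\<omega> \<in> inf_words S" "0 < n" "p \<in> cyl_image \<omega> n" "q \<in> cyl_image \<omega> n"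
    and "\<And>v x y. v \<in> verts S \<Longrightarrow> x \<in> piece S v \<Longrightarrow> y \<in> piece S v \<Longrightarrow> dist x y \<le> \<Delta>"
  shows "dist p q \<le> contraction_ratio ^ n * \<Delta>"
proof -
  obtain x y where xy: "x \<in> piece S (ter S (\<omega> (n - 1)))" "y \<in> piece S (ter S (\<omega> (n - 1)))"
    "p = word_map S (map \<omega> [0..<n]) x" "q = word_map S (map \<omega> [0..<n]) y"
    using assms by blast
  then have "dist p q \<le> contraction_ratio ^ n * dist x y"
    using dist_word_map_le[OF prefix_in_fin_words[OF assms(1), of 0 n], of x y]
      last_map_upt[OF assms(2), of \<omega>] assms(2) by simp
  also have "\<dots> \<le> contraction_ratio ^ n * \<Delta>"
    using assms(5)[OF ter_verts[OF inf_words_edge[OF assms(1)]] xy(1,2)] contraction_ratio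
    by (intro mult_left_mono) auto
  finally show ?thesis .
qed

text \<open>Cantor's intersection theorem: the images are compact, non-empty and nested, because
  each map sends its piece into the piece at the terminal vertex of the preceding letter, and their
  diameters decay geometrically.\<close>

lemma ex1_coding:
  assumes "\<omega> \<in> inf_words S"
  shows "\<exists>!x. x \<in> (\<Inter>n\<in>{1..}. cyl_image \<omega> n)"
proof -
  let ?A = "\<lambda>n. cyl_image \<omega> (Suc n)"
  have fw: "map \<omega> [0..<Suc n] \<in> fin_words S" "map \<omega> [0..<Suc n] \<noteq> []" for n
    using prefix_in_fin_words[OF assms, of 0 "Suc n"] by (simp_all del: upt_Suc)
  have ter: "ter S (\<omega> k) \<in> verts S" for k
    using ter_verts inf_words_edge[OF assms] by blast
  have cpt: "compact (?A n)" for n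
    using continuous_on_word_map[OF fw, of n] piece_compact[OF ter, of n]
    by (intro compact_continuous_image) (simp_all add: last_map)
  have ne: "?A n \<noteq> {}" for n
    using piece_nonempty[OF ter] by auto
  have "?A (Suc n) \<subseteq> ?A n" for n
  proof -
    have "gmap S (\<omega> (Suc n)) ` piece S (ter S (\<omega> (Suc n))) \<subseteq> piece S (ter S (\<omega> n))"
      using gmap_into[OF inf_words_edge[OF assms]] ter_eq_ini[OF assms] by simp
    then have "word_map S (map \<omega> [0..<Suc n]) `
        (gmap S (\<omega> (Suc n)) ` piece S (ter S (\<omega> (Suc n)))) \<subseteq> ?A n"
      by auto
    moreover have "word_map S (map \<omega> [0..<Suc (Suc n)])
        = word_map S (map \<omega> [0..<Suc n]) \<circ> gmap S (\<omega> (Suc n))"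
      by (simp add: word_map_append comp_assoc)
    ultimately show ?thesis
      by (simp add: image_comp)
  qed
  then have anti: "?A n \<subseteq> ?A m" if "m \<le> n" for m n
    using that by (rule lift_Suc_antimono_le)
  have "?A 0 \<inter> (\<Inter>n. ?A n) \<noteq> {}"
  proof (rule compact_imp_fip_image[OF cpt[of 0], of UNIV ?A])
    fix I :: "nat set" assume "finite I"
    then have "?A (Max (insert 0 I)) \<subseteq> ?A 0 \<inter> (\<Inter>n\<in>I. ?A n)"
      by (intro Int_greatest INT_greatest anti) auto
    then show "?A 0 \<inter> (\<Inter>n\<in>I. ?A n) \<noteq> {}"
      using ne by (metis subset_empty)
  qed (rule compact_imp_closed[OF cpt])
  then obtain z where z: "z \<in> (\<Inter>n. ?A n)"
    by (meson Int_emptyI)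
  have eq: "(\<Inter>n. ?A n) = (\<Inter>n\<in>{1..}. cyl_image \<omega> n)"
  proof -
    have "{1..} = range Suc"
      by (auto simp: image_iff Suc_le_eq gr0_conv_Suc)
    then show ?thesis
      by (simp only: image_image)
  qed
  have uniq: "x = y" if xy: "x \<in> (\<Inter>n. ?A n)" "y \<in> (\<Inter>n. ?A n)" for x y
  proof -
    obtain \<Delta> where \<Delta>: "\<And>v x y. v \<in> verts S \<Longrightarrow> x \<in> piece S v \<Longrightarrow> y \<in> piece S v \<Longrightarrow> dist x y \<le> \<Delta>"
      using pieces_diameter by metis
    have "dist x y \<le> contraction_ratio ^ Suc n * \<Delta>" for n
      using xy by (intro cyl_image_dist[OF assms _ _ _ \<Delta>]) auto
    moreover have "(\<lambda>n. contraction_ratio ^ Suc n * \<Delta>) \<longlonglongrightarrow> 0 * \<Delta>"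
      using contraction_ratio
      by (intro tendsto_mult[OF LIMSEQ_Suc[OF LIMSEQ_power_zero] tendsto_const]) simp
    ultimately have "dist x y \<le> 0"
      using LIMSEQ_le_const by fastforce
    then show ?thesis by simp
  qed
  show ?thesis
    unfolding eq[symmetric] using z uniq[OF _ z] by (rule ex1I)
qed

lemma coding_eqI:
  assumes "\<omega> \<in> inf_words S" "\<And>n. 0 < n \<Longrightarrow> x \<in> cyl_image \<omega> n"
  shows "coding S \<omega> = x"
  unfolding coding_def
  using assms(2) by (intro the1_equality[OF ex1_coding[OF assms(1)]]) auto

lemma coding_in_cyl_image:
  assumes "\<omega> \<in> inf_words S" "0 < n"
  shows "coding S \<omega> \<in> cyl_image \<omega> n"
  using theI'[OF ex1_coding[OF assms(1)]] assms(2) unfolding coding_def[symmetric] by auto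

lemma coding_in_piece:
  assumes "\<omega> \<in> inf_words S"
  shows "coding S \<omega> \<in> piece S (ini S (\<omega> 0))"
  using coding_in_cyl_image[OF assms, of 1] gmap_into[OF inf_words_edge[OF assms, of 0]] by auto

lemma coding_case_nat:
  assumes "case_nat e \<omega> \<in> inf_words S"
  shows "coding S (case_nat e \<omega>) = gmap S e (coding S \<omega>)"
proof (rule coding_eqI[OF assms])
  have \<omega>: "\<omega> \<in> inf_words S" and e: "e \<in> edges S" and inc: "incid S e (\<omega> 0)"
    using assms by (auto simp: case_nat_in_inf_words)
  fix n :: nat assume "0 < n"
  then obtain k where k: "n = Suc k"
    using gr0_implies_Suc by blast
  have m: "map (case_nat e \<omega>) [0..<Suc k] = e # map \<omega> [0..<k]"
    by (simp add: map_upt_Suc del: upt_Suc)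
  show "gmap S e (coding S \<omega>) \<in> cyl_image (case_nat e \<omega>) n"
  proof (cases k)
    \<comment> \<open>For \<open>n = 1\<close> no cylinder image of \<open>\<omega>\<close> is
      available; that the coded point lies in the piece at
      \<open>ini S (\<omega> 0) = ter S e\<close> replaces it.\<close>
    case 0
    then show ?thesis
      using coding_in_piece[OF \<omega>] incid_vertex[OF e inf_words_edge[OF \<omega>, of 0] inc] k by simp
  next
    case (Suc j)
    then have "coding S \<omega> \<in> cyl_image \<omega> k"
      using coding_in_cyl_image[OF \<omega>, of k] by simp
    then show ?thesis
      unfolding k m using Suc by (auto simp del: upt_Suc)
  qed
qed

lemma coding_prepend:
  assumes "prepend u \<omega> \<in> inf_words S"
  shows "coding S (prepend u \<omega>) = word_map S u (coding S \<omega>)"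
  using assms
proof (induction u)
  case (Cons e u)
  then have "prepend u \<omega> \<in> inf_words S"
    by (simp add: case_nat_in_inf_words)
  then show ?case
    using Cons coding_case_nat[of e "prepend u \<omega>"] by simp
qed simp

lemma coding_suffix:
  assumes "\<omega> \<in> inf_words S"
  shows "coding S \<omega> = word_map S (map \<omega> [0..<n]) (coding S (suffix_from n \<omega>))"
  using coding_prepend[of "map \<omega> [0..<n]" "suffix_from n \<omega>"] assms
  by (simp add: prepend_suffix_from)

text \<open>\<open>N\<close> depends on \<open>\<epsilon>\<close> alone, since the contraction ratio
  and the bound on the diameters are common to all pieces. It serves both the continuity of the
  coding and the choice of the finite word in \<open>ex_word_dense\<close>.\<close>

lemma coding_prefix_close:
  assumes "0 < \<epsilon>"
  obtains N where "0 < N"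
    "\<And>\<omega> \<tau>. \<omega> \<in> inf_words S \<Longrightarrow> \<tau> \<in> inf_words S \<Longrightarrow> (\<And>i. i < N \<Longrightarrow> \<tau> i = \<omega> i) \<Longrightarrow>
       dist (coding S \<tau>) (coding S \<omega>) < \<epsilon>"
proof -
  obtain \<Delta> where \<Delta>: "0 < \<Delta>"
    "\<And>v x y. v \<in> verts S \<Longrightarrow> x \<in> piece S v \<Longrightarrow> y \<in> piece S v \<Longrightarrow> dist x y \<le> \<Delta>"
    using pieces_diameter by metis
  obtain n where n: "contraction_ratio ^ n < \<epsilon> / \<Delta>"
    using real_arch_pow_inv[of "\<epsilon> / \<Delta>" contraction_ratio] contraction_ratio assms \<Delta> by auto
  have "contraction_ratio ^ Suc n \<le> 1 * contraction_ratio ^ n"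
    unfolding power_Suc using contraction_ratio by (intro mult_right_mono) auto
  then have "contraction_ratio ^ Suc n < \<epsilon> / \<Delta>"
    using n by linarith
  then have lt: "contraction_ratio ^ Suc n * \<Delta> < \<epsilon>"
    using \<Delta>(1) by (simp only: pos_less_divide_eq)
  show ?thesis
  proof
    show "0 < Suc n" by simp
    fix \<omega> \<tau> assume \<omega>: "\<omega> \<in> inf_words S" "\<tau> \<in> inf_words S" and eq: "\<And>i. i < Suc n \<Longrightarrow> \<tau> i = \<omega> i"
    have meq: "map \<tau> [0..<Suc n] = map \<omega> [0..<Suc n]"
      using eq by simp
    have "cyl_image \<tau> (Suc n) = cyl_image \<omega> (Suc n)"
      unfolding meq using eq[of n] by simp
    then have "coding S \<tau> \<in> cyl_image \<omega> (Suc n)"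
      using coding_in_cyl_image[OF \<omega>(2), of "Suc n"] by blast
    then have "dist (coding S \<tau>) (coding S \<omega>) \<le> contraction_ratio ^ Suc n * \<Delta>"
      using coding_in_cyl_image[OF \<omega>(1), of "Suc n"] \<Delta>(2)
      by (intro cyl_image_dist[OF \<omega>(1)]) auto
    then show "dist (coding S \<tau>) (coding S \<omega>) < \<epsilon>"
      using lt by linarith
  qed
qed

text \<open>Admissibility of a prefix \<open>u\<close> depends only on its last letter, so every
  word map ending in \<open>a\<close> sends this set into the limit set.\<close>

definition followers_limit_set :: "'e \<Rightarrow> 'a set" where
  "followers_limit_set a = coding S ` {\<omega> \<in> inf_words S. incid S a (\<omega> 0)}"

text \<open>Any letter can follow one of the finitely many words \<open>a w\<close> with \<open>w \<in> \<Lambda>\<close>, so the limit set is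
  a finite union of sets of the form \<open>followers_limit_set\<close>.\<close>

lemma ex_followers_not_uniformly_porous:
  assumes "finitely_irreducible S" "\<not> uniformly_porous (limit_set S)"
  shows "\<exists>a\<in>edges S. \<not> uniformly_porous (followers_limit_set a)"
proof (rule ccontr)
  assume "\<not> ?thesis"
  then have up: "\<And>a. a \<in> edges S \<Longrightarrow> uniformly_porous (followers_limit_set a)"
    by blast
  obtain \<Lambda> where \<Lambda>: "finite \<Lambda>"
    "\<And>a b. a \<in> edges S \<Longrightarrow> b \<in> edges S \<Longrightarrow> \<exists>w\<in>\<Lambda>. [a] @ w @ [b] \<in> fin_words S"
    using assms(1) unfolding finitely_irreducible_def by blast
  obtain a where a: "a \<in> edges S"
    using two_edges by blast
  define F where "F = {last (a # w) | w. w \<in> \<Lambda> \<and> a # w \<in> fin_words S}"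
  have "finite F" "F \<subseteq> edges S"
    unfolding F_def using \<Lambda>(1) last_in_edges by (auto simp del: last.simps)
  then have "uniformly_porous (\<Union>a\<in>F. followers_limit_set a)"
    using up by (intro uniformly_porous_UN) auto
  moreover have "limit_set S = (\<Union>a\<in>F. followers_limit_set a)"
  proof
    show "limit_set S \<subseteq> (\<Union>a\<in>F. followers_limit_set a)"
    proof
      fix x assume "x \<in> limit_set S"
      then obtain \<omega> where \<omega>: "\<omega> \<in> inf_words S" "x = coding S \<omega>"
        unfolding limit_set_def by blast
      then obtain w where w: "w \<in> \<Lambda>" "(a # w) @ [\<omega> 0] \<in> fin_words S"
        using \<Lambda>(2)[OF a inf_words_edge[of \<omega> S 0]] by auto
      then have "a # w \<in> fin_words S" "incid S (last (a # w)) (\<omega> 0)"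
        unfolding fin_words_append by auto
      then show "x \<in> (\<Union>a\<in>F. followers_limit_set a)"
        unfolding F_def followers_limit_set_def using w(1) \<omega> by blast
    qed
  qed (auto simp: followers_limit_set_def limit_set_def)
  ultimately show False
    using assms(2) by simp
qed

end

section \<open>Conformal transport of dense balls\<close>

text \<open>A quantitative open mapping theorem, proved by continuity in the radius. Let
  \<open>R\<close> be the largest radius up to \<open>m * \<rho>\<close> whose ball lies in the
  image. On that ball the inverse is Lipschitz with constant \<open>1 / m\<close>, so if
  \<open>R < m * \<rho>\<close> the ball is covered by the image of a compact ball of radius
  \<open>R / m < \<rho>\<close>. Its closure is then in the image too, and openness of the image
  lets \<open>R\<close> grow, a contradiction.\<close>

lemma ball_subset_image_ball:
  fixes f :: "'a::euclidean_space \<Rightarrow> 'a"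
  assumes "0 < \<rho>" "0 < m" and inj: "inj_on f (ball p \<rho>)"
    and der: "\<And>x. x \<in> ball p \<rho> \<Longrightarrow> (f has_derivative f' x) (at x)"
    and expand: "\<And>x v. x \<in> ball p \<rho> \<Longrightarrow> m * norm v \<le> norm (f' x v)"
  shows "ball (f p) (m * \<rho>) \<subseteq> f ` ball p \<rho>"
proof -
  let ?B = "ball p \<rho>" and ?g = "the_inv_into (ball p \<rho>) f"
  have cont: "continuous_on ?B f"
    using der has_derivative_continuous continuous_at_imp_continuous_on by blast
  \<comment> \<open>The derivative is not assumed continuous here; invariance of domain gives
    openness from continuity and injectivity.\<close>
  then have "open (f ` ?B)"
    using inj by (intro invariance_of_domain) auto
  have gf: "?g (f x) = x" if "x \<in> ?B" for x
    using the_inv_into_f_f[OF inj that] .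
  \<comment> \<open>The mean value inequality for the inverse needs a convex domain, hence the
    restriction to a ball already known to lie in the image.\<close>
  have g_lip: "norm (?g z - ?g z') \<le> (1 / m) * norm (z - z')"
    if b: "ball (f p) R \<subseteq> f ` ?B" and z: "z \<in> ball (f p) R" "z' \<in> ball (f p) R" for R z z'
  proof -
    have "\<exists>g'. (?g has_derivative g') (at z) \<and> onorm g' \<le> 1 / m" if zf: "z \<in> f ` ?B" for z
    proof -
      obtain x where x: "x \<in> ?B" "z = f x"
        using zf by blast
      have lin: "linear (f' x)"
        using der[OF x(1)] has_derivative_linear by blast
      moreover have "inj (f' x)"
        unfolding linear_injective_0[OF lin]
        using expand[OF x(1)] \<open>0 < m\<close>
        by (metis norm_le_zero_iff norm_zero mult_le_0_iff not_le)
      ultimately obtain g' where g': "linear g'" "\<And>v. f' x (g' v) = v"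
        using linear_injective_isomorphism by blast
      have "(?g has_derivative g') (at z)"
        unfolding x(2)
        using has_derivative_inverse_strong[OF open_ball x(1) cont gf der[OF x(1)], of g'] g'(2)
        by (simp add: fun_eq_iff)
      moreover have "onorm g' \<le> 1 / m"
        using expand[OF x(1), of "g' _"] g'(2) \<open>0 < m\<close>
        by (intro onorm_le) (simp add: field_simps)
      ultimately show ?thesis by blast
    qed
    then obtain G where G: "\<And>z. z \<in> f ` ?B \<Longrightarrow> (?g has_derivative G z) (at z) \<and> onorm (G z) \<le> 1 / m"
      by metis
    show ?thesis
    proof (rule differentiable_bound[OF convex_ball _ _ z])
      fix w assume "w \<in> ball (f p) R"
      then show "(?g has_derivative G w) (at w within ball (f p) R)" "onorm (G w) \<le> 1 / m"
        using G b has_derivative_at_withinI by blast+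
    qed
  qed
  define T where "T = {R. 0 \<le> R \<and> R \<le> m * \<rho> \<and> ball (f p) R \<subseteq> f ` ?B}"
  define R where "R = Sup T"
  have T0: "0 \<in> T" and bdd: "bdd_above T"
    unfolding T_def using assms(1,2) by (auto intro!: bdd_aboveI[of _ "m * \<rho>"])
  have "R \<le> m * \<rho>"
    unfolding R_def
  proof (rule cSup_least)
    show "T \<noteq> {}"
      using T0 by blast
  qed (simp add: T_def)
  moreover have "0 \<le> R"
    unfolding R_def by (rule cSup_upper[OF T0 bdd])
  ultimately have R0: "0 \<le> R" "R \<le> m * \<rho>"
    by blast+
  have bR: "ball (f p) R \<subseteq> f ` ?B"
  proof
    fix z assume "z \<in> ball (f p) R"
    then have "dist (f p) z < Sup T"
      unfolding R_def by simp
    then obtain R' where "R' \<in> T" "dist (f p) z < R'"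
      using T0 less_cSupD by blast
    then show "z \<in> f ` ?B"
      unfolding T_def by auto
  qed
  have "R = m * \<rho>"
  proof (rule ccontr)
    assume "R \<noteq> m * \<rho>"
    then have lt: "R / m < \<rho>"
      using R0 \<open>0 < m\<close> by (simp add: field_simps)
    let ?C = "f ` cball p (R / m)"
    have "cball p (R / m) \<subseteq> ?B"
      using lt by auto
    then have "compact ?C" and C: "?C \<subseteq> f ` ?B"
      using cont by (auto intro!: compact_continuous_image intro: continuous_on_subset)
    have "ball (f p) R \<subseteq> ?C"
    proof
      fix z assume z: "z \<in> ball (f p) R"
      then obtain x where x: "x \<in> ?B" "z = f x"
        using bR by blast
      have "0 < R"
        using z by (meson mem_ball zero_le_dist le_less_trans)
      then have "norm (?g z - ?g (f p)) \<le> (1 / m) * norm (z - f p)"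
        using g_lip[OF bR z, of "f p"] by simp
      then have "norm (x - p) \<le> (1 / m) * norm (z - f p)"
        using gf x assms(1) by simp
      also have "\<dots> \<le> R / m"
        using z \<open>0 < m\<close> by (simp add: dist_norm norm_minus_commute divide_right_mono)
      finally show "z \<in> ?C"
        using x by (auto simp: dist_norm norm_minus_commute)
    qed
    then have "closure (ball (f p) R) \<subseteq> ?C"
      using \<open>compact ?C\<close> by (simp add: closure_minimal compact_imp_closed)
    \<comment> \<open>For \<open>R = 0\<close> the open ball and its closure are empty, so the
      centre is supplied separately.\<close>
    moreover have "f p \<in> ?C"
      using R0 \<open>0 < m\<close> by auto
    ultimately have "cball (f p) R \<subseteq> ?C"
      using R0 by (cases "R = 0") auto
    then have "cball (f p) R \<subseteq> f ` ?B"
      using C by blast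
    moreover have "open (f ` ?B)" by fact
    ultimately obtain \<epsilon> where e: "\<epsilon> > 0" "(\<Union>x\<in>cball (f p) R. ball x \<epsilon>) \<subseteq> f ` ?B"
      using compact_subset_open_imp_ball_epsilon_subset[OF compact_cball] by blast
    \<comment> \<open>A point beyond distance \<open>R\<close> is within \<open>\<epsilon>\<close>
      of its radial projection \<open>?x\<close> onto the sphere of radius \<open>R\<close>.\<close>
    have "ball (f p) (R + \<epsilon>) \<subseteq> (\<Union>x\<in>cball (f p) R. ball x \<epsilon>)"
    proof
      fix z assume z: "z \<in> ball (f p) (R + \<epsilon>)"
      let ?d = "norm (z - f p)"
      have d: "?d < R + \<epsilon>"
        using z by (simp add: dist_norm norm_minus_commute)
      show "z \<in> (\<Union>x\<in>cball (f p) R. ball x \<epsilon>)"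
      proof (cases "?d \<le> R")
        case True
        then show ?thesis
          using e(1) by (intro UN_I[of z]) (auto simp: dist_norm norm_minus_commute)
      next
        case False
        let ?x = "f p + (R / ?d) *\<^sub>R (z - f p)"
        have "z - ?x = (1 - R / ?d) *\<^sub>R (z - f p)"
          by (simp add: algebra_simps)
        then have "norm (z - ?x) = \<bar>1 - R / ?d\<bar> * ?d"
          by (simp only: norm_scaleR)
        also have "\<dots> = ?d - R"
          using False R0 by (auto simp: field_simps abs_if)
        finally have "z \<in> ball ?x \<epsilon>"
          using d by (simp add: dist_norm norm_minus_commute)
        moreover have "?x \<in> cball (f p) R"
          using False R0 by (auto simp: dist_norm)
        ultimately show ?thesis by blast
      qed
    qed
    then have "ball (f p) (R + \<epsilon>) \<subseteq> f ` ?B"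
      using e(2) by blast
    then have "min (R + \<epsilon>) (m * \<rho>) \<in> T"
      unfolding T_def using R0 e(1) assms(1,2) by (auto simp: subset_iff)
    then have "min (R + \<epsilon>) (m * \<rho>) \<le> R"
      unfolding R_def using bdd by (intro cSup_upper)
    then show False
      using e(1) \<open>R \<noteq> m * \<rho>\<close> R0 by auto
  qed
  then show ?thesis
    using bR by simp
qed

text \<open>Conformality with its scaling factor made explicit. The factor equals
  \<open>deriv_norm\<close>, and it multiplies exactly under composition, as operator norms in
  general do not.\<close>

definition similarity_deriv :: "('a::euclidean_space \<Rightarrow> 'a) \<Rightarrow> real \<Rightarrow> 'a \<Rightarrow> bool" where
  "similarity_deriv f c p \<longleftrightarrow>
     0 < c \<and> (\<exists>f'. (f has_derivative f') (at p) \<and> (\<forall>v. norm (f' v) = c * norm v))"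

lemma similarity_deriv_imp_deriv_norm:
  assumes "similarity_deriv f c p"
  shows "deriv_norm f p = c"
proof -
  obtain f' where f': "(f has_derivative f') (at p)" "\<And>v. norm (f' v) = c * norm v" and "0 < c"
    using assms unfolding similarity_deriv_def by blast
  have "onorm f' = c"
  proof (rule antisym)
    show "onorm f' \<le> c"
      by (intro onorm_le) (simp add: f'(2))
    obtain b :: 'a where "b \<in> Basis"
      using nonempty_Basis by blast
    then have "c = norm (f' b)"
      by (simp add: f'(2))
    also have "\<dots> \<le> onorm f' * norm b"
      using f'(1) has_derivative_bounded_linear by (intro onorm) blast
    finally show "c \<le> onorm f'"
      using \<open>b \<in> Basis\<close> by simp
  qed
  then show ?thesis
    using frechet_derivative_at[OF f'(1)] unfolding deriv_norm_def by simp
qed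

lemma similarity_deriv_compose:
  assumes "similarity_deriv f c p" "similarity_deriv g d (f p)"
  shows "similarity_deriv (g \<circ> f) (d * c) p"
proof -
  obtain f' g' where "(f has_derivative f') (at p)" "\<And>v. norm (f' v) = c * norm v"
    "(g has_derivative g') (at (f p))" "\<And>v. norm (g' v) = d * norm v" "0 < c" "0 < d"
    using assms unfolding similarity_deriv_def by blast
  then show ?thesis
    unfolding similarity_deriv_def
    by (intro conjI exI[of _ "g' \<circ> f'"] diff_chain_at) auto
qed

text \<open>Pieces and cores need not be convex, so this is applied to a ball inside a core.\<close>

lemma norm_diff_le_of_deriv_norm_le:
  assumes "convex A" "x \<in> A" "y \<in> A"
    and "\<And>p. p \<in> A \<Longrightarrow> similarity_deriv f (deriv_norm f p) p"
    and "\<And>p. p \<in> A \<Longrightarrow> deriv_norm f p \<le> B"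
  shows "dist (f x) (f y) \<le> B * dist x y"
proof -
  have "\<forall>p\<in>A. \<exists>f'. (f has_derivative f') (at p) \<and> (\<forall>v. norm (f' v) = deriv_norm f p * norm v)"
    using assms(4) unfolding similarity_deriv_def by blast
  then obtain F where F: "\<And>p. p \<in> A \<Longrightarrow> (f has_derivative F p) (at p)"
    "\<And>p v. p \<in> A \<Longrightarrow> norm (F p v) = deriv_norm f p * norm v"
    by metis
  show ?thesis
    unfolding dist_norm
  proof (rule differentiable_bound[OF assms(1) _ _ assms(2,3)])
    fix p assume "p \<in> A"
    then show "(f has_derivative F p) (at p within A)"
      using F(1) has_derivative_at_withinI by blast
    show "onorm (F p) \<le> B"
      using F(2)[OF \<open>p \<in> A\<close>] assms(5)[OF \<open>p \<in> A\<close>] by (intro onorm_le) (simp add: mult_right_mono)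
  qed
qed

lemma ball_subset_image_ball_deriv_norm:
  assumes "0 < \<rho>" "0 < m" "inj_on f (ball p \<rho>)"
    and "\<And>x. x \<in> ball p \<rho> \<Longrightarrow> similarity_deriv f (deriv_norm f x) x"
    and "\<And>x. x \<in> ball p \<rho> \<Longrightarrow> m \<le> deriv_norm f x"
  shows "ball (f p) (m * \<rho>) \<subseteq> f ` ball p \<rho>"
proof -
  have "\<forall>x\<in>ball p \<rho>. \<exists>f'. (f has_derivative f') (at x) \<and> (\<forall>v. norm (f' v) = deriv_norm f x * norm v)"
    using assms(4) unfolding similarity_deriv_def by blast
  then obtain F where F: "\<And>x. x \<in> ball p \<rho> \<Longrightarrow> (f has_derivative F x) (at x)"
    "\<And>x v. x \<in> ball p \<rho> \<Longrightarrow> norm (F x v) = deriv_norm f x * norm v"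
    by metis
  show ?thesis
    using F(2) assms(5)
    by (intro ball_subset_image_ball[OF assms(1,2,3) F(1)]) (simp_all add: mult_right_mono)
qed

section \<open>Derivatives and bounded distortion of word maps\<close>

context conformal_gdms
begin

lemma gmap_nbhd:
  assumes "e \<in> edges S"
  shows "gmap S e ` nbhd S (ter S e) \<subseteq> nbhd S (ini S e)" "inj_on (gmap S e) (nbhd S (ter S e))"
    and "p \<in> nbhd S (ter S e) \<Longrightarrow> similarity_deriv (gmap S e) (deriv_norm (gmap S e) p) p"
    and "continuous_on (nbhd S (ter S e)) (deriv_norm (gmap S e))"
proof -
  let ?W = "nbhd S (ter S e)" and ?f = "gmap S e"
  obtain f' :: "'a \<Rightarrow> 'a \<Rightarrow>\<^sub>L 'a" where f':
    "\<And>p. p \<in> ?W \<Longrightarrow> (?f has_derivative blinfun_apply (f' p)) (at p)"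
    "continuous_on ?W f'"
    "\<And>p. p \<in> ?W \<Longrightarrow> \<exists>c>0. \<forall>v. norm (blinfun_apply (f' p) v) = c * norm v"
    using gmap_conformal[OF assms] unfolding C1_conformal_diffeo_into_def by blast
  show "?f ` ?W \<subseteq> nbhd S (ini S e)" "inj_on ?f ?W"
    using gmap_conformal[OF assms] unfolding C1_conformal_diffeo_into_def by blast+
  show "similarity_deriv ?f (deriv_norm ?f p) p" if p: "p \<in> ?W"
  proof -
    obtain c where "similarity_deriv ?f c p"
      using f'(1,3)[OF p] unfolding similarity_deriv_def by blast
    then show ?thesis
      using similarity_deriv_imp_deriv_norm by blast
  qed
  \<comment> \<open>The norm of bounded linear maps is the operator norm, so continuity of
    \<open>f'\<close> passes to \<open>deriv_norm\<close>.\<close>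
  have "deriv_norm ?f p = norm (f' p)" if "p \<in> ?W" for p
    using frechet_derivative_at[OF f'(1)[OF that]] unfolding deriv_norm_def
    by (simp add: norm_blinfun.rep_eq)
  then show "continuous_on ?W (deriv_norm ?f)"
    using continuous_on_norm[OF f'(2)] by (simp cong: continuous_on_cong)
qed

text \<open>The induction runs on the sets \<open>nbhd\<close>, which the extended maps respect; no
  such invariance is assumed for the cores.\<close>

lemma word_map_nbhd:
  assumes "u \<in> fin_words S" "u \<noteq> []"
  shows "word_map S u ` nbhd S (ter S (last u)) \<subseteq> nbhd S (ini S (hd u))"
    and "inj_on (word_map S u) (nbhd S (ter S (last u)))"
    and "p \<in> nbhd S (ter S (last u)) \<Longrightarrow>
           similarity_deriv (word_map S u) (deriv_norm (word_map S u) p) p"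
proof -
  have "word_map S u ` nbhd S (ter S (last u)) \<subseteq> nbhd S (ini S (hd u)) \<and>
    inj_on (word_map S u) (nbhd S (ter S (last u))) \<and>
    (\<forall>p\<in>nbhd S (ter S (last u)). similarity_deriv (word_map S u) (deriv_norm (word_map S u) p) p)"
    using assms
  proof (induction u)
    case (Cons e u)
    show ?case
    proof (cases "u = []")
      case True
      then show ?thesis
        using Cons.prems gmap_nbhd[of e] by (auto simp: fin_words_Cons)
    next
      case False
      then have e: "e \<in> edges S" "ter S e = ini S (hd u)" and u: "u \<in> fin_words S"
        using Cons.prems incid_vertex[of e "hd u"] hd_in_edges[of u S] by (auto simp: fin_words_Cons)
      note IH = Cons.IH[OF u False]
      have "similarity_deriv (gmap S e \<circ> word_map S u) (deriv_norm (gmap S e \<circ> word_map S u) p) p"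
        if "p \<in> nbhd S (ter S (last u))" for p
      proof -
        have "similarity_deriv (word_map S u) (deriv_norm (word_map S u) p) p"
          "similarity_deriv (gmap S e) (deriv_norm (gmap S e) (word_map S u p)) (word_map S u p)"
          using IH that gmap_nbhd(3)[OF e(1)] e(2) by auto
        then have "similarity_deriv (gmap S e \<circ> word_map S u)
          (deriv_norm (gmap S e) (word_map S u p) * deriv_norm (word_map S u) p) p"
          by (rule similarity_deriv_compose)
        then show ?thesis
          using similarity_deriv_imp_deriv_norm by metis
      qed
      moreover have "inj_on (gmap S e \<circ> word_map S u) (nbhd S (ter S (last u)))"
        using IH gmap_nbhd(2)[OF e(1)] e(2) by (auto intro: comp_inj_on inj_on_subset)
      moreover have "(gmap S e \<circ> word_map S u) ` nbhd S (ter S (last u)) \<subseteq> nbhd S (ini S e)"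
        using IH gmap_nbhd(1)[OF e(1)] e(2) by fastforce
      ultimately show ?thesis
        unfolding word_map_Cons last_ConsR[OF False] list.sel by blast
    qed
  qed simp
  then show "word_map S u ` nbhd S (ter S (last u)) \<subseteq> nbhd S (ini S (hd u))"
    "inj_on (word_map S u) (nbhd S (ter S (last u)))"
    "p \<in> nbhd S (ter S (last u)) \<Longrightarrow>
       similarity_deriv (word_map S u) (deriv_norm (word_map S u) p) p"
    by blast+
qed

lemma deriv_norm_word_map_pos:
  assumes "u \<in> fin_words S" "u \<noteq> []" "p \<in> nbhd S (ter S (last u))"
  shows "0 < deriv_norm (word_map S u) p"
  using word_map_nbhd(3)[OF assms] unfolding similarity_deriv_def by blast

text \<open>For similarities the chain rule is an equality of norms. This is the cocycle identity
  behind \<open>weighted_pull_Cons\<close>.\<close>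

lemma deriv_norm_word_map_Cons:
  assumes "e # u \<in> fin_words S" "u \<noteq> []" "p \<in> nbhd S (ter S (last u))"
  shows "deriv_norm (word_map S (e # u)) p =
           deriv_norm (gmap S e) (word_map S u p) * deriv_norm (word_map S u) p"
proof -
  have e: "e \<in> edges S" "ter S e = ini S (hd u)" and u: "u \<in> fin_words S"
    using assms(1,2) incid_vertex[of e "hd u"] hd_in_edges[of u S] by (auto simp: fin_words_Cons)
  have "word_map S u p \<in> nbhd S (ter S e)"
    using word_map_nbhd(1)[OF u assms(2)] assms(3) e(2) by auto
  then show ?thesis
    unfolding word_map_Cons
    by (intro similarity_deriv_imp_deriv_norm similarity_deriv_compose
        word_map_nbhd(3)[OF u assms(2,3)] gmap_nbhd(3)[OF e(1)])
qed

lemma piece_subset_core: "v \<in> verts S \<Longrightarrow> piece S v \<subseteq> core S v"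
  using piece_core interior_subset by blast

lemma ter_last_in_verts: "u \<in> fin_words S \<Longrightarrow> u \<noteq> [] \<Longrightarrow> ter S (last u) \<in> verts S"
  using last_in_edges ter_verts by blast

text \<open>The bounded distortion constant, fixed once and stated as a product instead of a
  quotient.\<close>

definition distortion :: real where
  "distortion = (SOME K. 1 \<le> K \<and> (\<forall>w\<in>fin_words S. w \<noteq> [] \<longrightarrow>
     (\<forall>p\<in>core S (ter S (last w)). \<forall>q\<in>core S (ter S (last w)).
        deriv_norm (word_map S w) p \<le> K * deriv_norm (word_map S w) q)))"

lemma distortion_ge_1: "1 \<le> distortion"
  and deriv_norm_le_distortion:
    "u \<in> fin_words S \<Longrightarrow> u \<noteq> [] \<Longrightarrow> p \<in> core S (ter S (last u)) \<Longrightarrow> q \<in> core S (ter S (last u)) \<Longrightarrow>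
       deriv_norm (word_map S u) p \<le> distortion * deriv_norm (word_map S u) q"
proof -
  let ?P = "\<lambda>K. 1 \<le> K \<and> (\<forall>w\<in>fin_words S. w \<noteq> [] \<longrightarrow>
     (\<forall>p\<in>core S (ter S (last w)). \<forall>q\<in>core S (ter S (last w)).
        deriv_norm (word_map S w) p \<le> K * deriv_norm (word_map S w) q))"
  obtain K where K: "1 \<le> K" "\<And>w p q. w \<in> fin_words S \<Longrightarrow> w \<noteq> [] \<Longrightarrow>
      p \<in> core S (ter S (last w)) \<Longrightarrow> q \<in> core S (ter S (last w)) \<Longrightarrow>
      deriv_norm (word_map S w) p / deriv_norm (word_map S w) q \<le> K"
    using bounded_distortion by blast
  have "deriv_norm (word_map S w) p \<le> K * deriv_norm (word_map S w) q"
    if "w \<in> fin_words S" "w \<noteq> []" "p \<in> core S (ter S (last w))" "q \<in> core S (ter S (last w))"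
    for w p q
  proof -
    have "0 < deriv_norm (word_map S w) q"
      using deriv_norm_word_map_pos[OF that(1,2)] core_nbhd[OF ter_last_in_verts[OF that(1,2)]] that
      by blast
    then show ?thesis
      using K(2)[OF that] by (simp only: pos_divide_le_eq)
  qed
  then have "?P K"
    using K(1) by blast
  then have "?P distortion"
    unfolding distortion_def by (rule someI[of ?P])
  then show "1 \<le> distortion"
    "u \<in> fin_words S \<Longrightarrow> u \<noteq> [] \<Longrightarrow> p \<in> core S (ter S (last u)) \<Longrightarrow> q \<in> core S (ter S (last u)) \<Longrightarrow>
       deriv_norm (word_map S u) p \<le> distortion * deriv_norm (word_map S u) q"
    by blast+
qed

text \<open>On a ball inside the core every derivative is at least the central one divided by
  \<open>distortion\<close>, which is the expansion bound that the open mapping estimate asks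
  for.\<close>

lemma ball_subset_image_ball_word_map:
  assumes u: "u \<in> fin_words S" "u \<noteq> []" and "0 < \<rho>" "ball p \<rho> \<subseteq> core S (ter S (last u))"
  shows "ball (word_map S u p) (deriv_norm (word_map S u) p / distortion * \<rho>)
           \<subseteq> word_map S u ` ball p \<rho>"
proof -
  have K: "0 < distortion"
    using distortion_ge_1 by linarith
  have p: "p \<in> core S (ter S (last u))"
    using assms by auto
  have W: "ball p \<rho> \<subseteq> nbhd S (ter S (last u))"
    using assms core_nbhd[OF ter_last_in_verts[OF u]] by blast
  show ?thesis
  proof (rule ball_subset_image_ball_deriv_norm[OF \<open>0 < \<rho>\<close>])
    show "0 < deriv_norm (word_map S u) p / distortion"
      using deriv_norm_word_map_pos[OF u] W \<open>0 < \<rho>\<close> K by (simp add: subset_iff)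
    show "inj_on (word_map S u) (ball p \<rho>)"
      using word_map_nbhd(2)[OF u] W inj_on_subset by blast
    fix x assume x: "x \<in> ball p \<rho>"
    show "similarity_deriv (word_map S u) (deriv_norm (word_map S u) x) x"
      using word_map_nbhd(3)[OF u] W x by blast
    show "deriv_norm (word_map S u) p / distortion \<le> deriv_norm (word_map S u) x"
      using deriv_norm_le_distortion[OF u p, of x] assms(4) x K
      by (simp add: pos_divide_le_eq mult.commute subset_iff)
  qed
qed

text \<open>A word map contracts a ball inside the piece, while its image contains a ball whose radius is
  proportional to the derivative.\<close>

lemma deriv_norm_word_map_bounded:
  assumes u: "u \<in> fin_words S" "u \<noteq> []" and p: "p \<in> core S (ter S (last u))"
  shows "deriv_norm (word_map S u) p \<le> distortion\<^sup>2"
proof -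
  let ?v = "ter S (last u)" and ?f = "word_map S u"
  have v: "?v \<in> verts S"
    using ter_last_in_verts[OF u] .
  have K: "0 < distortion"
    using distortion_ge_1 by linarith
  \<comment> \<open>A non-empty piece equals the closure of its interior, so it contains a ball,
    where the contraction estimate applies.\<close>
  obtain q where "q \<in> interior (piece S ?v)"
    using piece_nonempty[OF v] piece_regular[OF v] by (metis closure_eq_empty equals0I)
  then obtain \<rho> where \<rho>: "0 < \<rho>" "ball q \<rho> \<subseteq> piece S ?v"
    using mem_interior by blast
  let ?m = "deriv_norm ?f q / distortion"
  have core: "ball q \<rho> \<subseteq> core S ?v"
    using \<rho>(2) piece_subset_core[OF v] by blast
  have "?f ` ball q \<rho> \<subseteq> cball (?f q) \<rho>"
  proof (rule image_subsetI)
    fix x assume x: "x \<in> ball q \<rho>"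
    have "dist (?f q) (?f x) \<le> contraction_ratio ^ length u * dist q x"
      using x \<rho> by (intro dist_word_map_le[OF u]) auto
    also have "\<dots> \<le> 1 * dist q x"
      using contraction_ratio by (intro mult_right_mono) (auto simp: power_le_one)
    finally show "?f x \<in> cball (?f q) \<rho>"
      using x by simp
  qed
  then have "ball (?f q) (?m * \<rho>) \<subseteq> cball (?f q) \<rho>"
    using ball_subset_image_ball_word_map[OF u \<rho>(1) core] by blast
  then have "?m * \<rho> \<le> \<rho>"
    using \<rho>(1) unfolding ball_subset_cball_iff by auto
  then have "?m \<le> 1"
    using mult_le_cancel_right_pos[OF \<rho>(1), of ?m 1] by simp
  then have "deriv_norm ?f q \<le> distortion"
    using K by (simp add: field_simps)
  then have "distortion * deriv_norm ?f q \<le> distortion * distortion"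
    using K by simp
  moreover have "deriv_norm ?f p \<le> distortion * deriv_norm ?f q"
    using core \<rho>(1) by (intro deriv_norm_le_distortion[OF u p]) auto
  ultimately show ?thesis
    by (simp add: power2_eq_square)
qed

lemma limit_set_dense_image:
  assumes u: "u \<in> fin_words S" "u \<noteq> []"
    and \<rho>: "0 < \<rho>" "ball p \<rho> \<subseteq> core S (ter S (last u))" and \<epsilon>: "0 < \<epsilon>" "\<epsilon> \<le> 1"
    and dense: "\<And>y. ball y (\<epsilon> * \<rho> / (2 * distortion\<^sup>2)) \<subseteq> ball p \<rho> \<Longrightarrow>
                  ball y (\<epsilon> * \<rho> / (2 * distortion\<^sup>2)) \<inter> followers_limit_set (last u) \<noteq> {}"
    and R: "R = deriv_norm (word_map S u) p / distortion * (\<rho> / 2)"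
    and z: "ball z (\<epsilon> * R) \<subseteq> ball (word_map S u p) R"
  shows "ball z (\<epsilon> * R) \<inter> limit_set S \<noteq> {}"
proof -
  let ?f = "word_map S u" and ?K = distortion
  define D where "D = deriv_norm ?f p"
  define \<delta> where "\<delta> = \<epsilon> * \<rho> / (2 * ?K\<^sup>2)"
  have K: "1 \<le> ?K" "0 < ?K"
    using distortion_ge_1 by auto
  have p: "p \<in> core S (ter S (last u))"
    using \<rho> by auto
  have W: "ball p \<rho> \<subseteq> nbhd S (ter S (last u))"
    using \<rho>(2) core_nbhd[OF ter_last_in_verts[OF u]] by blast
  have D: "0 < D"
    unfolding D_def using deriv_norm_word_map_pos[OF u] W \<rho>(1) by (simp add: subset_iff)
  have R0: "0 < R"
    using R D K \<rho>(1) by (simp add: D_def)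
  have "z \<in> ball (?f p) R"
    using z R0 \<epsilon>(1) by (auto simp: subset_iff)
  then obtain y where y: "y \<in> ball p (\<rho> / 2)" "z = ?f y"
    using ball_subset_image_ball_word_map[OF u, of "\<rho> / 2" p] \<rho> R by (auto simp: subset_iff)
  have "\<epsilon> * \<rho> \<le> 1 * \<rho>" "1 \<le> ?K\<^sup>2"
    using \<epsilon> \<rho>(1) K(1) by (auto intro: mult_right_mono)
  then have "\<epsilon> * \<rho> / (2 * ?K\<^sup>2) \<le> \<rho> / 2"
    using \<rho>(1) \<epsilon>(1) frac_le[of \<rho> "\<epsilon> * \<rho>" 2 "2 * ?K\<^sup>2"] by simp
  then have "ball y \<delta> \<subseteq> ball p \<rho>"
    unfolding ball_subset_ball_iff \<delta>_def using y(1) by (simp add: dist_commute)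
  then obtain x where x: "x \<in> ball y \<delta>" "x \<in> followers_limit_set (last u)" "x \<in> ball p \<rho>"
    using dense[of y] unfolding \<delta>_def by blast
  have "dist (?f y) (?f x) \<le> (?K * D) * dist y x"
  proof (rule norm_diff_le_of_deriv_norm_le[OF convex_ball[of p \<rho>]])
    show "y \<in> ball p \<rho>" "x \<in> ball p \<rho>"
      using y(1) x(3) \<rho>(1) by auto
    fix q assume q: "q \<in> ball p \<rho>"
    then show "similarity_deriv ?f (deriv_norm ?f q) q"
      using word_map_nbhd(3)[OF u] W by blast
    show "deriv_norm ?f q \<le> ?K * D"
      unfolding D_def using deriv_norm_le_distortion[OF u _ p] q \<rho>(2) by blast
  qed
  also have "\<dots> < (?K * D) * \<delta>"
    using x(1) K(2) D by simp
  also have "\<dots> = \<epsilon> * R"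
    unfolding \<delta>_def R D_def[symmetric] using K(2) by (simp add: field_simps power2_eq_square)
  finally have "?f x \<in> ball z (\<epsilon> * R)"
    using y(2) by simp
  moreover have "?f x \<in> limit_set S"
  proof -
    obtain \<omega> where \<omega>: "\<omega> \<in> inf_words S" "incid S (last u) (\<omega> 0)" "x = coding S \<omega>"
      using x(2) unfolding followers_limit_set_def by blast
    then have "prepend u \<omega> \<in> inf_words S"
      using u by (simp add: prepend_in_inf_words)
    then show ?thesis
      unfolding limit_set_def \<omega>(3) using coding_prepend by (metis imageI)
  qed
  ultimately show ?thesis
    by blast
qed

text \<open>The radius obtained depends on the place where \<open>w\<close> occurs, through the
  derivative of the preceding map, but the relative density \<open>\<epsilon>\<close> does not. One
  finite word thus serves all infinite words containing it.\<close>

lemma ex_word_dense: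
  assumes irr: "finitely_irreducible S" and np: "\<not> uniformly_porous (limit_set S)"
    and \<epsilon>: "0 < \<epsilon>" "\<epsilon> \<le> 1"
  obtains w where "w \<in> fin_words S" "w \<noteq> []"
    "\<And>\<tau> n. \<tau> \<in> inf_words S \<Longrightarrow> map \<tau> [n..<n + length w] = w \<Longrightarrow>
       \<exists>r. 0 < r \<and> r < \<epsilon> \<and>
         (\<forall>y. ball y (\<epsilon> * r) \<subseteq> ball (coding S \<tau>) r \<longrightarrow> ball y (\<epsilon> * r) \<inter> limit_set S \<noteq> {})"
proof -
  let ?K = distortion
  have K: "1 \<le> ?K" "0 < ?K"
    using distortion_ge_1 by auto
  obtain a where a: "a \<in> edges S" and npa: "\<not> uniformly_porous (followers_limit_set a)"
    using ex_followers_not_uniformly_porous[OF irr np] by blast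
  have ta: "ter S a \<in> verts S"
    using ter_verts[OF a] .
  \<comment> \<open>\<open>\<eta>\<close> is a margin: balls of this radius around points of the
    compact piece stay in the core.\<close>
  obtain \<eta> where \<eta>: "0 < \<eta>" "(\<Union>x\<in>piece S (ter S a). ball x \<eta>) \<subseteq> interior (core S (ter S a))"
    using compact_subset_open_imp_ball_epsilon_subset[OF piece_compact[OF ta] open_interior
        piece_core[OF ta]] by blast
  \<comment> \<open>This is the density that \<open>limit_set_dense_image\<close> requires for
    radius \<open>r / 2\<close>, expressed relative to \<open>r\<close>.\<close>
  define c where "c = \<epsilon> / (4 * ?K\<^sup>2)"
  have "1 \<le> ?K\<^sup>2"
    using K(1) by simp
  then have c: "0 < c" "c \<le> 1 / 4"
    unfolding c_def using \<epsilon> K(2) frac_le[of 1 \<epsilon> 4 "4 * ?K\<^sup>2"] by auto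
  \<comment> \<open>The bound \<open>2 * \<eta>\<close> puts balls of radius \<open>r / 2\<close>
    into the core; the bound \<open>\<epsilon> / ?K\<close> makes the transported radius
    \<open>?R\<close> smaller than \<open>\<epsilon>\<close>.\<close>
  obtain x r where r: "0 < r" "r < min (2 * \<eta>) (\<epsilon> / ?K)"
    and dense: "\<And>y. \<not> ball y (c * r) \<subseteq> ball x r - followers_limit_set a"
  proof -
    have "0 < min (2 * \<eta>) (\<epsilon> / ?K)"
      using \<eta>(1) \<epsilon>(1) K(2) by simp
    then show ?thesis
      using npa c(1) that unfolding uniformly_porous_def by meson
  qed
  have cr: "0 < c * r" "c * r \<le> r / 4"
    using c r(1) mult_right_mono[of c "1 / 4" r] by auto
  \<comment> \<open>The centre \<open>x\<close> is arbitrary; density applied to the small ball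
    around \<open>x\<close> itself yields a coded point close to it.\<close>
  have "ball x (c * r) \<subseteq> ball x r"
    using cr r(1) by (intro subset_ball) linarith
  then obtain \<omega> where \<omega>: "\<omega> \<in> inf_words S" "incid S a (\<omega> 0)" "dist x (coding S \<omega>) < c * r"
    using dense[of x] unfolding followers_limit_set_def by auto
  obtain N where N: "0 < N" "\<And>\<omega> \<tau>. \<omega> \<in> inf_words S \<Longrightarrow> \<tau> \<in> inf_words S \<Longrightarrow>
      (\<And>i. i < N \<Longrightarrow> \<tau> i = \<omega> i) \<Longrightarrow> dist (coding S \<tau>) (coding S \<omega>) < c * r"
    using coding_prefix_close[OF cr(1)] by metis
  define w where "w = a # map \<omega> [0..<N]"
  show ?thesis
  proof
    have "hd (map \<omega> [0..<N]) = \<omega> 0"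
      using N(1) by (simp add: hd_map)
    then show "w \<in> fin_words S"
      unfolding w_def fin_words_Cons using a \<omega>(2) prefix_in_fin_words[OF \<omega>(1)] by simp
    show "w \<noteq> []"
      by (simp add: w_def)
    fix \<tau> n assume \<tau>: "\<tau> \<in> inf_words S" and eq: "map \<tau> [n..<n + length w] = w"
    have \<tau>n: "\<tau> (n + i) = w ! i" if "i < Suc N" for i
    proof -
      have "map \<tau> [n..<n + length w] ! i = \<tau> (n + i)"
        using that by (subst nth_map) (simp_all add: w_def del: upt_Suc)
      then show ?thesis
        by (simp only: eq)
    qed
    define \<sigma> where "\<sigma> = suffix_from (Suc n) \<tau>"
    \<comment> \<open>\<open>u\<close> ends with the letter \<open>a\<close> of the occurrence, so
      the remaining word \<open>\<sigma>\<close> begins with the prefix of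
      \<open>\<omega>\<close>.\<close>
    define u where "u = map \<tau> [0..<Suc n]"
    define p where "p = coding S \<sigma>"
    have u: "u \<in> fin_words S" "u \<noteq> []" "last u = a"
      unfolding u_def using prefix_in_fin_words[OF \<tau>, of 0 "Suc n"] \<tau>n[of 0] by (simp_all add: w_def)
    have \<sigma>: "\<sigma> \<in> inf_words S"
      unfolding \<sigma>_def by (rule suffix_from_in_inf_words[OF \<tau>])
    have "\<sigma> i = \<omega> i" if "i < N" for i
      using \<tau>n[of "Suc i"] that by (simp add: \<sigma>_def suffix_from_def w_def)
    then have "dist p (coding S \<omega>) < c * r"
      unfolding p_def using N(2)[OF \<omega>(1) \<sigma>] by blast
    \<comment> \<open>Two errors of at most \<open>r / 4\<close> each, one from \<open>x\<close> to
      the point coded by \<open>\<omega>\<close> and one from there to \<open>p\<close>.\<close>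
    then have "dist x p < r / 2"
      using \<omega>(3) cr(2) dist_triangle2[of x p "coding S \<omega>"] by linarith
    then have xr: "ball p (r / 2) \<subseteq> ball x r"
      unfolding ball_subset_ball_iff using r(1) by (simp add: dist_commute)
    have "\<tau> (Suc n) = \<sigma> 0" "\<tau> n = a"
      using \<tau>n[of 0] by (simp_all add: \<sigma>_def suffix_from_def w_def)
    then have "p \<in> piece S (ter S a)"
      unfolding p_def using coding_in_piece[OF \<sigma>] ter_eq_ini[OF \<tau>, of n] by simp
    moreover have "ball p (r / 2) \<subseteq> ball p \<eta>"
      using r(2) by (intro subset_ball) simp
    ultimately have core: "ball p (r / 2) \<subseteq> core S (ter S (last u))"
      using \<eta>(2) interior_subset u(3) by blast
    have \<delta>: "\<epsilon> * (r / 2) / (2 * ?K\<^sup>2) = c * r"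
      by (simp add: c_def)
    let ?R = "deriv_norm (word_map S u) p / ?K * (r / 2 / 2)"
    have \<tau>p: "coding S \<tau> = word_map S u p"
      unfolding u_def p_def \<sigma>_def by (rule coding_suffix[OF \<tau>])
    have dn: "ball z (\<epsilon> * ?R) \<inter> limit_set S \<noteq> {}"
      if "ball z (\<epsilon> * ?R) \<subseteq> ball (coding S \<tau>) ?R" for z
    proof (rule limit_set_dense_image[OF u(1,2) _ core \<epsilon> _ refl])
      show "ball z (\<epsilon> * ?R) \<subseteq> ball (word_map S u p) ?R"
        using that unfolding \<tau>p .
      fix y assume "ball y (\<epsilon> * (r / 2) / (2 * ?K\<^sup>2)) \<subseteq> ball p (r / 2)"
      then show "ball y (\<epsilon> * (r / 2) / (2 * ?K\<^sup>2)) \<inter> followers_limit_set (last u) \<noteq> {}"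
        unfolding \<delta> u(3) using dense[of y] xr by blast
    qed (use r(1) in simp)
    have pc: "p \<in> core S (ter S (last u))"
      using core r(1) by auto
    have "0 < deriv_norm (word_map S u) p"
      using deriv_norm_word_map_pos[OF u(1,2)] core_nbhd[OF ter_last_in_verts[OF u(1,2)]] pc by blast
    then have "0 < ?R"
      using K(2) r(1) by simp
    moreover have "?R < \<epsilon>"
    proof -
      have "?R \<le> ?K\<^sup>2 / ?K * (r / 2 / 2)"
        using deriv_norm_word_map_bounded[OF u(1,2) pc] K(2) r(1)
        by (intro mult_right_mono divide_right_mono) auto
      also have "\<dots> = ?K * r / 4"
        using K(2) by (simp add: power2_eq_square)
      also have "\<dots> < \<epsilon>"
      proof -
        have "r * ?K < \<epsilon>"
          using r(2) K(2) by (simp add: pos_less_divide_eq)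
        moreover have "0 < r * ?K"
          using r(1) K(2) by simp
        ultimately show ?thesis
          by (simp add: mult.commute)
      qed
      finally show ?thesis .
    qed
    ultimately show "\<exists>r. 0 < r \<and> r < \<epsilon> \<and>
         (\<forall>y. ball y (\<epsilon> * r) \<subseteq> ball (coding S \<tau>) r \<longrightarrow> ball y (\<epsilon> * r) \<inter> limit_set S \<noteq> {})"
      using dn by blast
  qed
qed

end

section \<open>Eigenmeasures on cylinders\<close>

definition cylinder :: "('v, 'e, 'a, 'z) gdms_data_scheme \<Rightarrow> 'e list \<Rightarrow> (nat \<Rightarrow> 'e) set" where
  "cylinder S u = {\<omega> \<in> inf_words S. \<forall>i<length u. \<omega> i = u ! i}"

text \<open>The neighbourhood filter of \<open>\<omega>\<close> in the word topology, given by its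
  base of prefix cylinders. It opens the calculus of limits along filters to functions on
  words.\<close>

definition word_nhds :: "('v, 'e, 'a, 'z) gdms_data_scheme \<Rightarrow> (nat \<Rightarrow> 'e) \<Rightarrow> (nat \<Rightarrow> 'e) filter" where
  "word_nhds S \<omega> = (INF n. principal {\<tau> \<in> inf_words S. \<forall>i<n. \<tau> i = \<omega> i})"

definition word_continuous ::
    "('v, 'e, 'a, 'z) gdms_data_scheme \<Rightarrow> ((nat \<Rightarrow> 'e) \<Rightarrow> 'b::topological_space) \<Rightarrow> bool" where
  "word_continuous S f \<longleftrightarrow> (\<forall>\<omega>\<in>inf_words S. (f \<longlongrightarrow> f \<omega>) (word_nhds S \<omega>))"

lemma eventually_word_nhds:
  "eventually P (word_nhds S \<omega>) \<longleftrightarrow>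
     (\<exists>n. \<forall>\<tau>\<in>inf_words S. (\<forall>i<n. \<tau> i = \<omega> i) \<longrightarrow> P \<tau>)"
proof -
  have "\<exists>k\<in>UNIV. principal {\<tau> \<in> inf_words S. \<forall>i<k. \<tau> i = \<omega> i}
      \<le> inf (principal {\<tau> \<in> inf_words S. \<forall>i<m. \<tau> i = \<omega> i})
          (principal {\<tau> \<in> inf_words S. \<forall>i<n. \<tau> i = \<omega> i})" for m n
    by (intro bexI[of _ "max m n"]) auto
  then have "eventually P (word_nhds S \<omega>) \<longleftrightarrow>
      (\<exists>n\<in>UNIV. eventually P (principal {\<tau> \<in> inf_words S. \<forall>i<n. \<tau> i = \<omega> i}))"
    unfolding word_nhds_def by (intro eventually_INF_base) auto
  then show ?thesis
    by (simp add: eventually_principal Ball_def imp_conjL)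
qed

lemma word_nhds_inf_words: "eventually (\<lambda>\<tau>. \<tau> \<in> inf_words S) (word_nhds S \<omega>)"
  by (auto simp: eventually_word_nhds)

lemma word_nhds_nth: "eventually (\<lambda>\<tau>. \<tau> i = \<omega> i) (word_nhds S \<omega>)"
  unfolding eventually_word_nhds by (intro exI[of _ "Suc i"]) auto

lemma word_continuous_cong:
  assumes "\<And>\<omega>. \<omega> \<in> inf_words S \<Longrightarrow> f \<omega> = g \<omega>"
  shows "word_continuous S f \<longleftrightarrow> word_continuous S g"
proof -
  have "(f \<longlongrightarrow> l) (word_nhds S \<omega>) \<longleftrightarrow> (g \<longlongrightarrow> l) (word_nhds S \<omega>)" for l \<omega>
    by (intro tendsto_cong eventually_mono[OF word_nhds_inf_words] assms)
  then show ?thesis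
    unfolding word_continuous_def using assms by simp
qed

lemma topspace_word_topology: "topspace (word_topology S) = inf_words S"
  by (auto simp: word_topology_def inf_words_def)

lemma openin_cylinder: "openin (word_topology S) (cylinder S u)"
proof (cases "set u \<subseteq> edges S")
  case True
  let ?B = "\<lambda>i. if i < length u then {u ! i} else edges S"
  have "{i. ?B i \<noteq> edges S} \<subseteq> {..<length u}"
    by auto
  then have "finite {i. ?B i \<noteq> edges S}"
    using finite_subset by blast
  moreover have "openin (discrete_topology (edges S)) (?B i)" for i
    using True by (auto simp: subset_iff)
  ultimately have "openin (product_topology (\<lambda>_. discrete_topology (edges S)) UNIV) (PiE UNIV ?B)"
    unfolding openin_PiE_gen by simp
  moreover have "cylinder S u = PiE UNIV ?B \<inter> inf_words S"
    by (auto simp: cylinder_def inf_words_def PiE_iff split: if_splits)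
  ultimately show ?thesis
    unfolding word_topology_def openin_subtopology by blast
next
  case False
  then obtain i where "i < length u" "u ! i \<notin> edges S"
    unfolding subset_iff in_set_conv_nth by blast
  then have "\<omega> \<notin> cylinder S u" for \<omega>
    using inf_words_edge[of \<omega> S i] by (auto simp: cylinder_def dest!: spec[of _ i])
  then have "cylinder S u = {}"
    by blast
  then show ?thesis
    by simp
qed

lemma mem_cylinder_prefix: "\<omega> \<in> inf_words S \<Longrightarrow> \<omega> \<in> cylinder S (map \<omega> [0..<n])"
  by (simp add: cylinder_def)

lemma cylinder_append_subset: "cylinder S (u @ v) \<subseteq> cylinder S u"
  unfolding cylinder_def by (auto simp: nth_append)

lemma mem_cylinderD: "\<tau> \<in> cylinder S u \<Longrightarrow> map \<tau> [0..<length u] = u"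
  unfolding cylinder_def by (auto intro: nth_equalityI)

lemma case_nat_mem_cylinder:
  "case_nat e \<omega> \<in> cylinder S (e' # u) \<longleftrightarrow>
     case_nat e \<omega> \<in> inf_words S \<and> e = e' \<and> \<omega> \<in> cylinder S u"
  by (auto simp: cylinder_def case_nat_in_inf_words All_less_Suc2)

lemma prepend_mem_cylinder:
  "prepend u \<omega> \<in> inf_words S \<Longrightarrow> prepend u \<omega> \<in> cylinder S (u @ v) \<longleftrightarrow> \<omega> \<in> cylinder S v"
proof (induction u)
  case (Cons e u)
  then show ?case
    by (simp add: case_nat_mem_cylinder case_nat_in_inf_words)
qed simp

lemma openin_word_topology_vimage:
  assumes "word_continuous S f" "open U"
  shows "openin (word_topology S) {\<omega> \<in> inf_words S. f \<omega> \<in> U}"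
proof (subst openin_subopen, intro ballI)
  fix \<omega> assume \<omega>: "\<omega> \<in> {\<omega> \<in> inf_words S. f \<omega> \<in> U}"
  then have "eventually (\<lambda>\<tau>. f \<tau> \<in> U) (word_nhds S \<omega>)"
    using assms topological_tendstoD unfolding word_continuous_def by blast
  then obtain n where n: "\<And>\<tau>. \<tau> \<in> inf_words S \<Longrightarrow> (\<And>i. i < n \<Longrightarrow> \<tau> i = \<omega> i) \<Longrightarrow> f \<tau> \<in> U"
    unfolding eventually_word_nhds by blast
  have "cylinder S (map \<omega> [0..<n]) \<subseteq> {\<omega> \<in> inf_words S. f \<omega> \<in> U}"
    using n by (auto simp: cylinder_def)
  then show "\<exists>T. openin (word_topology S) T \<and> \<omega> \<in> T \<and> T \<subseteq> {\<omega> \<in> inf_words S. f \<omega> \<in> U}"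
    using \<omega>
    by (intro exI[of _ "cylinder S (map \<omega> [0..<n])"] conjI openin_cylinder mem_cylinder_prefix) auto
qed

lemma sets_word_borel:
  "sets (word_borel S) = sigma_sets (inf_words S) {U. openin (word_topology S) U}"
  unfolding word_borel_def
  using openin_subset[of "word_topology S"] by (intro sets_measure_of) (auto simp: topspace_word_topology)

lemma openin_in_sets_word_borel: "openin (word_topology S) U \<Longrightarrow> U \<in> sets (word_borel S)"
  unfolding sets_word_borel by blast

definition bounded_word_continuous ::
    "('v, 'e, 'a, 'z) gdms_data_scheme \<Rightarrow> ((nat \<Rightarrow> 'e) \<Rightarrow> real) \<Rightarrow> bool" where
  "bounded_word_continuous S g \<longleftrightarrow> word_continuous S g \<and> bounded (g ` inf_words S)"

lemma bounded_word_continuous_cong: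
  assumes "\<And>\<omega>. \<omega> \<in> inf_words S \<Longrightarrow> f \<omega> = g \<omega>"
  shows "bounded_word_continuous S f \<longleftrightarrow> bounded_word_continuous S g"
  unfolding bounded_word_continuous_def
  using word_continuous_cong[of S f g] assms by (metis image_cong)

lemma bounded_word_continuous_const: "bounded_word_continuous S (\<lambda>_. c)"
  unfolding bounded_word_continuous_def word_continuous_def
  by (auto intro: boundedI[of _ "\<bar>c\<bar>"])

text \<open>Cylinders are clopen, so their indicators are test functions and the dual eigenvalue
  equation speaks about cylinder measures directly, with no approximation.\<close>

lemma bounded_word_continuous_indicator: "bounded_word_continuous S (indicator (cylinder S u))"
  unfolding bounded_word_continuous_def word_continuous_def
proof (intro conjI ballI)
  fix \<omega> assume \<omega>: "\<omega> \<in> inf_words S"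
  have "eventually (\<lambda>\<tau>. indicator (cylinder S u) \<tau> = (indicator (cylinder S u) \<omega> :: real))
      (word_nhds S \<omega>)"
    unfolding eventually_word_nhds
    using \<omega> by (intro exI[of _ "length u"]) (auto simp: cylinder_def indicator_def)
  then show "((indicator (cylinder S u) :: _ \<Rightarrow> real) \<longlongrightarrow> indicator (cylinder S u) \<omega>) (word_nhds S \<omega>)"
    by (rule tendsto_eventually)
next
  show "bounded ((indicator (cylinder S u) :: _ \<Rightarrow> real) ` inf_words S)"
    by (intro boundedI[of _ 1]) (auto simp: indicator_def)
qed

lemma bounded_word_continuous_mult:
  assumes "bounded_word_continuous S f" "bounded_word_continuous S g"
  shows "bounded_word_continuous S (\<lambda>\<omega>. f \<omega> * g \<omega>)"
proof -
  obtain B C where B: "\<And>\<omega>. \<omega> \<in> inf_words S \<Longrightarrow> \<bar>f \<omega>\<bar> \<le> B"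
    and C: "\<And>\<omega>. \<omega> \<in> inf_words S \<Longrightarrow> \<bar>g \<omega>\<bar> \<le> C"
    using assms unfolding bounded_word_continuous_def bounded_iff by (auto simp: image_iff)
  have "\<bar>f \<omega> * g \<omega>\<bar> \<le> B * C" if "\<omega> \<in> inf_words S" for \<omega>
    unfolding abs_mult using B[OF that] C[OF that] by (intro mult_mono) auto
  then have "bounded ((\<lambda>\<omega>. f \<omega> * g \<omega>) ` inf_words S)"
    by (intro boundedI[of _ "B * C"]) auto
  then show ?thesis
    using assms unfolding bounded_word_continuous_def word_continuous_def
    by (auto intro: tendsto_mult)
qed

lemma continuous_map_word_topology:
  "word_continuous S f \<Longrightarrow> continuous_map (word_topology S) euclidean f"
  unfolding continuous_map_def
  by (simp add: topspace_word_topology openin_word_topology_vimage)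

lemma borel_measurable_word_continuous:
  fixes f :: "(nat \<Rightarrow> 'e) \<Rightarrow> 'b::topological_space"
  assumes "word_continuous S f" "space M = inf_words S" "sets M = sets (word_borel S)"
  shows "f \<in> borel_measurable M"
proof (rule borel_measurableI)
  fix U :: "'b set" assume "open U"
  then have "{\<omega> \<in> inf_words S. f \<omega> \<in> U} \<in> sets M"
    unfolding assms(3) using assms(1)
    by (intro openin_in_sets_word_borel openin_word_topology_vimage)
  also have "{\<omega> \<in> inf_words S. f \<omega> \<in> U} = f -` U \<inter> space M"
    unfolding assms(2) by blast
  finally show "f -` U \<inter> space M \<in> sets M" .
qed

lemma (in gdms) coding_word_continuous: "word_continuous S (coding S)"
  unfolding word_continuous_def
proof (intro ballI tendstoI)
  fix \<omega> and \<epsilon> :: real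
  assume \<omega>: "\<omega> \<in> inf_words S" and "0 < \<epsilon>"
  then obtain N where N: "\<And>\<omega> \<tau>. \<omega> \<in> inf_words S \<Longrightarrow> \<tau> \<in> inf_words S \<Longrightarrow>
      (\<And>i. i < N \<Longrightarrow> \<tau> i = \<omega> i) \<Longrightarrow> dist (coding S \<tau>) (coding S \<omega>) < \<epsilon>"
    using coding_prefix_close by metis
  then show "\<forall>\<^sub>F \<tau> in word_nhds S \<omega>. dist (coding S \<tau>) (coding S \<omega>) < \<epsilon>"
    unfolding eventually_word_nhds using \<omega> by blast
qed

text \<open>The contribution of the single inverse branch \<open>u\<close> to the iterate of the
  transfer operator of order \<open>length u\<close>.\<close>

definition weighted_pull ::
    "('v, 'e, 'a::euclidean_space, 'z) conformal_gdms_data_scheme \<Rightarrow> real \<Rightarrow> 'e list \<Rightarrow>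
       ((nat \<Rightarrow> 'e) \<Rightarrow> real) \<Rightarrow> (nat \<Rightarrow> 'e) \<Rightarrow> real" where
  "weighted_pull S t u g \<omega> =
     (if incid S (last u) (\<omega> 0)
      then g (prepend u \<omega>) * deriv_norm (word_map S u) (coding S \<omega>) powr t else 0)"

text \<open>The indicator kills every branch but \<open>e\<close>, so the infinite sum has at most
  one non-zero term.\<close>

lemma transfer_op_indicator:
  assumes "e \<in> edges S" "\<omega> \<in> inf_words S"
  shows "transfer_op S t (\<lambda>\<tau>. indicator (cylinder S [e]) \<tau> * g \<tau>) \<omega> = weighted_pull S t [e] g \<omega>"
proof -
  let ?F = "\<lambda>e'. indicator (cylinder S [e]) (case_nat e' \<omega>) * g (case_nat e' \<omega>) *
              deriv_norm (gmap S e') (coding S \<omega>) powr t"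
  have "transfer_op S t (\<lambda>\<tau>. indicator (cylinder S [e]) \<tau> * g \<tau>) \<omega> =
      infsum ?F {e' \<in> edges S. incid S e' (\<omega> 0)}"
    by (simp add: transfer_op_def)
  also have "\<dots> = infsum ?F ({e} \<inter> {e' \<in> edges S. incid S e' (\<omega> 0)})"
    by (rule infsum_cong_neutral) (auto simp: case_nat_mem_cylinder indicator_eq_0_iff)
  also have "\<dots> = (if incid S e (\<omega> 0) then ?F e else 0)"
    using assms(1) by (simp add: Int_insert_left)
  also have "\<dots> = weighted_pull S t [e] g \<omega>"
  proof -
    have "incid S e (\<omega> 0) \<Longrightarrow> case_nat e \<omega> \<in> cylinder S [e]"
      using assms by (simp add: case_nat_mem_cylinder case_nat_in_inf_words cylinder_def)
    then show ?thesis
      using assms(1) by (simp add: weighted_pull_def)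
  qed
  finally show ?thesis .
qed

section \<open>Cocycle property and continuity of single branches\<close>

context conformal_gdms
begin

lemma coding_in_piece_ter:
  assumes "u \<in> fin_words S" "u \<noteq> []" "\<omega> \<in> inf_words S" "incid S (last u) (\<omega> 0)"
  shows "coding S \<omega> \<in> piece S (ter S (last u))"
  using coding_in_piece[OF assms(3)]
    incid_vertex[OF last_in_edges[OF assms(1,2)] inf_words_edge[OF assms(3)] assms(4)] by simp

lemma coding_in_core_ter:
  assumes "u \<in> fin_words S" "u \<noteq> []" "\<omega> \<in> inf_words S" "incid S (last u) (\<omega> 0)"
  shows "coding S \<omega> \<in> core S (ter S (last u))"
  using coding_in_piece_ter[OF assms] piece_subset_core[OF ter_last_in_verts[OF assms(1,2)]] by blast

lemma coding_in_nbhd_ter: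
  assumes "u \<in> fin_words S" "u \<noteq> []" "\<omega> \<in> inf_words S" "incid S (last u) (\<omega> 0)"
  shows "coding S \<omega> \<in> nbhd S (ter S (last u))"
  using coding_in_core_ter[OF assms] core_nbhd[OF ter_last_in_verts[OF assms(1,2)]] by blast

lemma weighted_pull_Cons:
  assumes "e # u \<in> fin_words S" "u \<noteq> []" "\<omega> \<in> inf_words S"
  shows "weighted_pull S t (e # u) g \<omega> = weighted_pull S t u (weighted_pull S t [e] g) \<omega>"
proof (cases "incid S (last u) (\<omega> 0)")
  case True
  have u: "u \<in> fin_words S" and e: "incid S e (hd u)"
    using assms(1,2) by (auto simp: fin_words_Cons)
  have p: "coding S \<omega> \<in> nbhd S (ter S (last u))"
    using coding_in_nbhd_ter[OF u assms(2,3) True] .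
  have 0: "prepend u \<omega> 0 = hd u"
    using assms(2) by (simp add: prepend_nth hd_conv_nth)
  have "prepend u \<omega> \<in> inf_words S"
    using prepend_in_inf_words[OF assms(2)] u True assms(3) by blast
  then have "coding S (prepend u \<omega>) = word_map S u (coding S \<omega>)"
    by (rule coding_prepend)
  moreover have "deriv_norm (word_map S (e # u)) (coding S \<omega>) =
      deriv_norm (gmap S e) (word_map S u (coding S \<omega>)) * deriv_norm (word_map S u) (coding S \<omega>)"
    by (rule deriv_norm_word_map_Cons[OF assms(1,2) p])
  ultimately show ?thesis
    using assms(2) True 0 e by (simp add: weighted_pull_def powr_mult)
qed (use assms(2) in \<open>simp add: weighted_pull_def\<close>)

text \<open>Pulling back must again give a test function so that the eigenvalue equation can be
  iterated. Admissibility depends on the first letter only and is locally constant; the weight is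
  continuous through the coding map and bounded by
  \<open>deriv_norm_word_map_bounded\<close>.\<close>

lemma bounded_word_continuous_weighted_pull_letter:
  assumes e: "e \<in> edges S" and t: "0 \<le> t" and g: "bounded_word_continuous S g"
  shows "bounded_word_continuous S (weighted_pull S t [e] g)"
proof -
  have fw: "[e] \<in> fin_words S"
    using e by (simp add: fin_words_def)
  let ?D = "deriv_norm (gmap S e)"
  have "word_continuous S (weighted_pull S t [e] g)"
    unfolding word_continuous_def
  proof
    fix \<omega> assume \<omega>: "\<omega> \<in> inf_words S"
    show "(weighted_pull S t [e] g \<longlongrightarrow> weighted_pull S t [e] g \<omega>) (word_nhds S \<omega>)"
    proof (cases "incid S e (\<omega> 0)")
      case False
      have "\<forall>\<^sub>F \<tau> in word_nhds S \<omega>. weighted_pull S t [e] g \<tau> = weighted_pull S t [e] g \<omega>"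
        using word_nhds_nth[of 0 \<omega> S] by eventually_elim (use False in \<open>simp add: weighted_pull_def\<close>)
      then show ?thesis
        by (rule tendsto_eventually)
    next
      case True
      have p: "coding S \<omega> \<in> nbhd S (ter S e)"
        using coding_in_nbhd_ter[OF fw _ \<omega>] True by simp
      have "isCont ?D (coding S \<omega>)"
        using gmap_nbhd(4)[OF e] p nbhd_open[OF ter_verts[OF e]] continuous_on_eq_continuous_at
        by blast
      then have "((\<lambda>\<tau>. ?D (coding S \<tau>)) \<longlongrightarrow> ?D (coding S \<omega>)) (word_nhds S \<omega>)"
        using coding_word_continuous \<omega> unfolding word_continuous_def by (blast intro: isCont_tendsto_compose)
      moreover have "?D (coding S \<omega>) \<noteq> 0"
        using gmap_nbhd(3)[OF e p] by (auto simp: similarity_deriv_def)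
      ultimately have D: "((\<lambda>\<tau>. ?D (coding S \<tau>) powr t) \<longlongrightarrow> ?D (coding S \<omega>) powr t) (word_nhds S \<omega>)"
        by (intro tendsto_powr tendsto_const)
      have "case_nat e \<omega> \<in> inf_words S"
        using e True \<omega> by (simp add: case_nat_in_inf_words)
      then have lim: "(g \<longlongrightarrow> g (case_nat e \<omega>)) (word_nhds S (case_nat e \<omega>))"
        using g unfolding bounded_word_continuous_def word_continuous_def by blast
      have "filterlim (case_nat e) (word_nhds S (case_nat e \<omega>)) (word_nhds S \<omega>)"
        unfolding filterlim_iff eventually_word_nhds[of _ S "case_nat e \<omega>"]
      proof (intro allI impI)
        fix P assume "\<exists>n. \<forall>\<tau>\<in>inf_words S. (\<forall>i<n. \<tau> i = case_nat e \<omega> i) \<longrightarrow> P \<tau>"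
        then obtain n where n: "\<And>\<tau>. \<tau> \<in> inf_words S \<Longrightarrow> (\<And>i. i < n \<Longrightarrow> \<tau> i = case_nat e \<omega> i) \<Longrightarrow> P \<tau>"
          by blast
        \<comment> \<open>Agreement up to \<open>Suc n\<close> rather than \<open>n\<close> secures
          the first letter, hence admissibility of \<open>e\<close> before \<open>\<tau>\<close>,
          even for \<open>n = 0\<close>.\<close>
        have "P (case_nat e \<tau>)" if "\<tau> \<in> inf_words S" "\<forall>i<Suc n. \<tau> i = \<omega> i" for \<tau>
        proof (rule n)
          show "case_nat e \<tau> \<in> inf_words S"
            using that True e by (simp add: case_nat_in_inf_words)
          show "case_nat e \<tau> i = case_nat e \<omega> i" if "i < n" for i
            using that \<open>\<forall>i<Suc n. \<tau> i = \<omega> i\<close> by (simp split: nat.split)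
        qed
        then show "\<forall>\<^sub>F \<tau> in word_nhds S \<omega>. P (case_nat e \<tau>)"
          unfolding eventually_word_nhds by blast
      qed
      then have "((\<lambda>\<tau>. g (case_nat e \<tau>)) \<longlongrightarrow> g (case_nat e \<omega>)) (word_nhds S \<omega>)"
        by (rule filterlim_compose[OF lim])
      then have "((\<lambda>\<tau>. g (case_nat e \<tau>) * ?D (coding S \<tau>) powr t) \<longlongrightarrow> weighted_pull S t [e] g \<omega>)
          (word_nhds S \<omega>)"
        using tendsto_mult[OF _ D] True by (simp add: weighted_pull_def)
      moreover have "\<forall>\<^sub>F \<tau> in word_nhds S \<omega>.
          g (case_nat e \<tau>) * ?D (coding S \<tau>) powr t = weighted_pull S t [e] g \<tau>"
        using word_nhds_nth[of 0 \<omega> S] by eventually_elim (use True in \<open>simp add: weighted_pull_def\<close>)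
      ultimately show ?thesis
        by (rule Lim_transform_eventually)
    qed
  qed
  moreover obtain B where B: "\<And>\<omega>. \<omega> \<in> inf_words S \<Longrightarrow> \<bar>g \<omega>\<bar> \<le> B"
    using g unfolding bounded_word_continuous_def bounded_iff by (auto simp: image_iff)
  have "\<bar>weighted_pull S t [e] g \<omega>\<bar> \<le> \<bar>B\<bar> * (distortion\<^sup>2) powr t" if \<omega>: "\<omega> \<in> inf_words S" for \<omega>
  proof (cases "incid S e (\<omega> 0)")
    case True
    have "?D (coding S \<omega>) \<le> distortion\<^sup>2"
      using deriv_norm_word_map_bounded[OF fw, of "coding S \<omega>"] coding_in_core_ter[OF fw _ \<omega>] True
      by simp
    moreover have "0 \<le> ?D (coding S \<omega>)"
      using gmap_nbhd(3)[OF e] coding_in_nbhd_ter[OF fw _ \<omega>] True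
      by (auto simp: similarity_deriv_def less_imp_le)
    ultimately have "?D (coding S \<omega>) powr t \<le> (distortion\<^sup>2) powr t"
      using t by (intro powr_mono2)
    moreover have "\<bar>g (case_nat e \<omega>)\<bar> \<le> \<bar>B\<bar>"
      using B[of "case_nat e \<omega>"] e True \<omega> by (simp add: case_nat_in_inf_words)
    ultimately show ?thesis
      using True by (simp add: weighted_pull_def abs_mult mult_mono)
  qed (simp add: weighted_pull_def)
  then have "bounded (weighted_pull S t [e] g ` inf_words S)"
    by (intro boundedI[of _ "\<bar>B\<bar> * (distortion\<^sup>2) powr t"]) auto
  ultimately show ?thesis
    unfolding bounded_word_continuous_def by blast
qed

lemma bounded_word_continuous_weighted_pull:
  assumes "u \<in> fin_words S" "u \<noteq> []" "0 \<le> t" "bounded_word_continuous S g"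
  shows "bounded_word_continuous S (weighted_pull S t u g)"
  using assms
proof (induction u arbitrary: g)
  case (Cons e u)
  show ?case
  proof (cases "u = []")
    case True
    then show ?thesis
      using Cons.prems bounded_word_continuous_weighted_pull_letter by (simp add: fin_words_Cons)
  next
    case False
    then have "bounded_word_continuous S (weighted_pull S t u (weighted_pull S t [e] g))"
      using Cons bounded_word_continuous_weighted_pull_letter by (simp add: fin_words_Cons)
    then show ?thesis
      using weighted_pull_Cons[OF Cons.prems(1) False] bounded_word_continuous_cong by blast
  qed
qed simp

end

section \<open>Cylinder estimates for eigenmeasures\<close>

locale eigenmeasure_gdms = conformal_gdms S
  for S :: "('v, 'e, 'a::euclidean_space, 'z) conformal_gdms_data_scheme" +
  fixes t :: real and M :: "(nat \<Rightarrow> 'e) measure"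
  assumes eigen: "eigenmeasure S t M"
begin

sublocale prob_space M
  using eigen unfolding eigenmeasure_def by blast

definition eigenvalue :: real where
  "eigenvalue = exp (real_of_ereal (pressure S t))"

lemma eigenvalue_pos: "0 < eigenvalue"
  by (simp add: eigenvalue_def)

lemma exponent_nonneg: "0 \<le> t"
  using eigen unfolding eigenmeasure_def summable_exponent_def by blast

lemma space_M: "space M = inf_words S" and sets_M: "sets M = sets (word_borel S)"
  using eigen unfolding eigenmeasure_def by blast+

lemma cylinder_sets: "cylinder S u \<in> sets M"
  unfolding sets_M by (intro openin_in_sets_word_borel openin_cylinder)

lemma integrable_bounded_word_continuous:
  assumes "bounded_word_continuous S g"
  shows "integrable M g"
proof -
  obtain B where "\<And>\<omega>. \<omega> \<in> inf_words S \<Longrightarrow> \<bar>g \<omega>\<bar> \<le> B"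
    using assms unfolding bounded_word_continuous_def bounded_iff by (auto simp: image_iff)
  then show ?thesis
    using assms borel_measurable_word_continuous[OF _ space_M sets_M]
    unfolding bounded_word_continuous_def
    by (intro integrable_const_bound[of _ B] AE_I2) (auto simp: space_M)
qed

lemma eigen_integral_letter:
  assumes "e \<in> edges S" "bounded_word_continuous S g"
  shows "eigenvalue * (\<integral>\<omega>. indicator (cylinder S [e]) \<omega> * g \<omega> \<partial>M) =
           (\<integral>\<omega>. weighted_pull S t [e] g \<omega> \<partial>M)"
proof -
  let ?G = "\<lambda>\<omega>. indicator (cylinder S [e]) \<omega> * g \<omega>"
  have "bounded_word_continuous S ?G"
    by (intro bounded_word_continuous_mult bounded_word_continuous_indicator assms(2))
  then have "(\<integral>\<omega>. transfer_op S t ?G \<omega> \<partial>M) = eigenvalue * (\<integral>\<omega>. ?G \<omega> \<partial>M)"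
    using eigen continuous_map_word_topology
    unfolding eigenmeasure_def eigenvalue_def bounded_word_continuous_def by blast
  moreover have "(\<integral>\<omega>. transfer_op S t ?G \<omega> \<partial>M) = (\<integral>\<omega>. weighted_pull S t [e] g \<omega> \<partial>M)"
    by (intro Bochner_Integration.integral_cong refl transfer_op_indicator assms(1))
      (simp add: space_M)
  ultimately show ?thesis
    by simp
qed

text \<open>The eigenvalue equation is iterated letter by letter, peeling off the first letter
  \<open>e\<close>; the cocycle identity reassembles the branches.\<close>

lemma eigen_integral_cylinder:
  assumes "u \<in> fin_words S" "u \<noteq> []" "bounded_word_continuous S g"
  shows "eigenvalue ^ length u * (\<integral>\<omega>. indicator (cylinder S u) \<omega> * g \<omega> \<partial>M) =
           (\<integral>\<omega>. weighted_pull S t u g \<omega> \<partial>M)"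
  using assms
proof (induction u arbitrary: g)
  case (Cons e u)
  have e: "e \<in> edges S" and u: "u \<in> fin_words S"
    using Cons.prems(1) by (auto simp: fin_words_Cons)
  show ?case
  proof (cases "u = []")
    case True
    then show ?thesis
      using eigen_integral_letter[OF e Cons.prems(3)] by simp
  next
    case False
    let ?g = "\<lambda>\<omega>. indicator (cylinder S (e # u)) \<omega> * g \<omega>"
    have g': "bounded_word_continuous S ?g"
      by (intro bounded_word_continuous_mult bounded_word_continuous_indicator Cons.prems(3))
    have "cylinder S (e # u) \<subseteq> cylinder S [e]"
      using cylinder_append_subset[of S "[e]" u] by simp
    then have "?g \<omega> = indicator (cylinder S [e]) \<omega> * ?g \<omega>" for \<omega>
      by (auto simp: indicator_def)
    then have "eigenvalue * (\<integral>\<omega>. ?g \<omega> \<partial>M) = eigenvalue * (\<integral>\<omega>. indicator (cylinder S [e]) \<omega> * ?g \<omega> \<partial>M)"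
      by (metis (no_types, lifting))
    also have "\<dots> = (\<integral>\<omega>. weighted_pull S t [e] ?g \<omega> \<partial>M)"
      by (rule eigen_integral_letter[OF e g'])
    \<comment> \<open>Prefixing \<open>e\<close> enters the cylinder of \<open>e # u\<close> exactly
      when the rest lies in the cylinder of \<open>u\<close>.\<close>
    also have "\<dots> = (\<integral>\<omega>. indicator (cylinder S u) \<omega> * weighted_pull S t [e] g \<omega> \<partial>M)"
      by (intro Bochner_Integration.integral_cong refl)
        (simp add: space_M weighted_pull_def indicator_def case_nat_mem_cylinder
          case_nat_in_inf_words e)
    finally have "eigenvalue ^ length (e # u) * (\<integral>\<omega>. ?g \<omega> \<partial>M) =
        eigenvalue ^ length u * (\<integral>\<omega>. indicator (cylinder S u) \<omega> * weighted_pull S t [e] g \<omega> \<partial>M)"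
      by simp
    also have "\<dots> = (\<integral>\<omega>. weighted_pull S t u (weighted_pull S t [e] g) \<omega> \<partial>M)"
      by (intro Cons.IH[OF u False] bounded_word_continuous_weighted_pull_letter e
          exponent_nonneg Cons.prems(3))
    also have "\<dots> = (\<integral>\<omega>. weighted_pull S t (e # u) g \<omega> \<partial>M)"
      using weighted_pull_Cons[OF Cons.prems(1) False]
      by (intro Bochner_Integration.integral_cong refl) (simp add: space_M)
    finally show ?thesis .
  qed
qed simp

lemma measure_cylinder_le:
  assumes u: "u \<in> fin_words S" "u \<noteq> []" and q: "q \<in> core S (ter S (last u))"
  shows "eigenvalue ^ length u * prob (cylinder S u) \<le>
           (distortion * deriv_norm (word_map S u) q) powr t"
proof -
  have "eigenvalue ^ length u * (\<integral>\<omega>. indicator (cylinder S u) \<omega> * 1 \<partial>M) =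
      (\<integral>\<omega>. weighted_pull S t u (\<lambda>_. 1) \<omega> \<partial>M)"
    by (rule eigen_integral_cylinder[OF u bounded_word_continuous_const])
  also have "\<dots> \<le> (distortion * deriv_norm (word_map S u) q) powr t"
  proof (rule integral_le_const)
    show "integrable M (weighted_pull S t u (\<lambda>_. 1))"
      by (intro integrable_bounded_word_continuous bounded_word_continuous_weighted_pull u
          exponent_nonneg bounded_word_continuous_const)
    have "weighted_pull S t u (\<lambda>_. 1) \<omega> \<le> (distortion * deriv_norm (word_map S u) q) powr t"
      if "\<omega> \<in> inf_words S" for \<omega>
    proof (cases "incid S (last u) (\<omega> 0)")
      case True
      have "deriv_norm (word_map S u) (coding S \<omega>) \<le> distortion * deriv_norm (word_map S u) q"
        using deriv_norm_le_distortion[OF u coding_in_core_ter[OF u that True] q] .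
      moreover have "0 < deriv_norm (word_map S u) (coding S \<omega>)"
        using deriv_norm_word_map_pos[OF u coding_in_nbhd_ter[OF u that True]] .
      ultimately show ?thesis
        using True exponent_nonneg by (simp add: weighted_pull_def powr_mono2)
    qed (simp add: weighted_pull_def)
    then show "AE \<omega> in M. weighted_pull S t u (\<lambda>_. 1) \<omega>
        \<le> (distortion * deriv_norm (word_map S u) q) powr t"
      by (intro AE_I2) (simp add: space_M)
  qed
  finally show ?thesis
    using cylinder_sets by simp
qed

text \<open>Pulling the indicator of the cylinder of \<open>u @ v\<close> back along
  \<open>u\<close> leaves the weight of \<open>u\<close> on the cylinder of \<open>v\<close>, and
  distortion bounds this weight below by its value at \<open>q\<close>.\<close>

lemma measure_cylinder_append_ge:
  assumes uv: "u @ v \<in> fin_words S" "u \<noteq> []" "v \<noteq> []" and q: "q \<in> core S (ter S (last u))"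
  shows "(deriv_norm (word_map S u) q / distortion) powr t * prob (cylinder S v) \<le>
           eigenvalue ^ length u * prob (cylinder S (u @ v))"
proof -
  let ?c = "(deriv_norm (word_map S u) q / distortion) powr t"
  let ?g = "indicator (cylinder S (u @ v)) :: _ \<Rightarrow> real"
  have u: "u \<in> fin_words S" "u \<noteq> []" and inc: "incid S (last u) (hd v)"
    using uv by (auto simp: fin_words_append)
  have K: "0 < distortion"
    using distortion_ge_1 by linarith
  have "?c * prob (cylinder S v) = (\<integral>\<omega>. ?c * indicator (cylinder S v) \<omega> \<partial>M)"
    using cylinder_sets by simp
  also have "\<dots> \<le> (\<integral>\<omega>. weighted_pull S t u ?g \<omega> \<partial>M)"
  proof (rule integral_mono)
    show "integrable M (\<lambda>\<omega>. ?c * indicator (cylinder S v) \<omega>)"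
      by (intro integrable_bounded_word_continuous bounded_word_continuous_mult
          bounded_word_continuous_const bounded_word_continuous_indicator)
    show "integrable M (weighted_pull S t u ?g)"
      by (intro integrable_bounded_word_continuous bounded_word_continuous_weighted_pull u
          exponent_nonneg bounded_word_continuous_indicator)
    fix \<omega> assume "\<omega> \<in> space M"
    then have \<omega>: "\<omega> \<in> inf_words S"
      by (simp add: space_M)
    show "?c * indicator (cylinder S v) \<omega> \<le> weighted_pull S t u ?g \<omega>"
    proof (cases "\<omega> \<in> cylinder S v")
      case True
      then have "\<omega> 0 = hd v"
        using uv(3) by (simp add: cylinder_def hd_conv_nth)
      then have inc0: "incid S (last u) (\<omega> 0)"
        using inc by simp
      then have "prepend u \<omega> \<in> cylinder S (u @ v)"
        using True prepend_mem_cylinder[of u \<omega> S v] prepend_in_inf_words[OF u(2)] u(1) \<omega> by blast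
      moreover have "deriv_norm (word_map S u) q / distortion \<le> deriv_norm (word_map S u) (coding S \<omega>)"
        using deriv_norm_le_distortion[OF u q coding_in_core_ter[OF u \<omega> inc0]] K
        by (simp add: field_simps)
      moreover have "0 \<le> deriv_norm (word_map S u) q / distortion"
        using deriv_norm_word_map_pos[OF u] q core_nbhd[OF ter_last_in_verts[OF u]] K
        by (auto intro!: divide_nonneg_pos less_imp_le)
      ultimately show ?thesis
        using True inc0 exponent_nonneg by (simp add: weighted_pull_def powr_mono2)
    qed (simp add: weighted_pull_def)
  qed
  also have "\<dots> = eigenvalue ^ length u * (\<integral>\<omega>. indicator (cylinder S u) \<omega> * ?g \<omega> \<partial>M)"
    by (rule eigen_integral_cylinder[OF u bounded_word_continuous_indicator, symmetric])
  also have "(\<lambda>\<omega>. indicator (cylinder S u) \<omega> * ?g \<omega>) = ?g"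
    using cylinder_append_subset[of S u v] by (auto simp: indicator_def fun_eq_iff)
  finally show ?thesis
    using cylinder_sets by simp
qed

lemma ex_core_point: "u \<in> fin_words S \<Longrightarrow> u \<noteq> [] \<Longrightarrow> \<exists>q. q \<in> core S (ter S (last u))"
  using piece_nonempty piece_subset_core ter_last_in_verts by blast

text \<open>The upper bound for \<open>u\<close> and the lower bound for \<open>u @ v\<close> are
  taken at the same point \<open>q\<close>. The power of the eigenvalue and the derivative cancel,
  leaving a constant independent of both words.\<close>

lemma measure_cylinder_supermultiplicative:
  assumes uv: "u @ v \<in> fin_words S" "u \<noteq> []" "v \<noteq> []"
  shows "(1 / distortion\<^sup>2) powr t * prob (cylinder S u) * prob (cylinder S v) \<le>
           prob (cylinder S (u @ v))"
proof -
  let ?m = "\<lambda>w. prob (cylinder S w)" and ?K = distortion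
  have u: "u \<in> fin_words S" "u \<noteq> []"
    using uv by (auto simp: fin_words_append)
  have K: "0 < ?K"
    using distortion_ge_1 by linarith
  obtain q where q: "q \<in> core S (ter S (last u))"
    using ex_core_point[OF u] by blast
  define D where "D = deriv_norm (word_map S u) q"
  have D: "0 < D"
    unfolding D_def using deriv_norm_word_map_pos[OF u] q core_nbhd[OF ter_last_in_verts[OF u]] by blast
  have "D / ?K = (1 / ?K\<^sup>2) * (?K * D)"
    using K by (simp add: field_simps power2_eq_square)
  then have eq: "(D / ?K) powr t = (1 / ?K\<^sup>2) powr t * (?K * D) powr t"
    by (simp only: powr_mult)
  have "(1 / ?K\<^sup>2) powr t * (eigenvalue ^ length u * ?m u) * ?m v \<le>
      (1 / ?K\<^sup>2) powr t * (?K * D) powr t * ?m v"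
    using measure_cylinder_le[OF u q] unfolding D_def
    by (intro mult_right_mono mult_left_mono) auto
  also have "\<dots> \<le> eigenvalue ^ length u * ?m (u @ v)"
    using measure_cylinder_append_ge[OF uv q] unfolding D_def[symmetric] eq .
  finally have "eigenvalue ^ length u * ((1 / ?K\<^sup>2) powr t * ?m u * ?m v) \<le>
      eigenvalue ^ length u * ?m (u @ v)"
    by (simp add: ac_simps)
  then show ?thesis
    using eigenvalue_pos by simp
qed

lemma ex_letter_pos: "\<exists>b\<in>edges S. 0 < prob (cylinder S [b])"
proof (rule ccontr)
  assume "\<not> ?thesis"
  then have "prob (cylinder S [b]) = 0" if "b \<in> edges S" for b
    using that zero_less_measure_iff by blast
  then have "cylinder S [b] \<in> null_sets M" if "b \<in> edges S" for b
    using that cylinder_sets by (intro null_setsI) (simp_all add: emeasure_eq_measure)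
  then have "(\<Union>b\<in>edges S. cylinder S [b]) \<in> null_sets M"
    by (intro null_sets_UN' countable_edges)
  moreover have "(\<Union>b\<in>edges S. cylinder S [b]) = space M"
    by (auto simp: space_M cylinder_def inf_words_def)
  ultimately show False
    using emeasure_space_1 by auto
qed

text \<open>Some letter \<open>b\<close> has positive measure because countably many cylinders cover
  the space. Irreducibility leads from \<open>v\<close> to \<open>b\<close>, and the lower bound
  transfers positivity.\<close>

lemma measure_cylinder_pos:
  assumes irr: "finitely_irreducible S" and v: "v \<in> fin_words S" "v \<noteq> []"
  shows "0 < prob (cylinder S v)"
proof -
  obtain b where b: "b \<in> edges S" "0 < prob (cylinder S [b])"
    using ex_letter_pos by blast
  obtain w where w: "[last v] @ w @ [b] \<in> fin_words S"
    using irr last_in_edges[OF v] b(1) unfolding finitely_irreducible_def by blast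
  have vw: "(v @ w) @ [b] \<in> fin_words S" "v @ w \<noteq> []"
    using w v by (cases "w = []"; simp add: fin_words_append fin_words_Cons)+
  then have fw: "v @ w \<in> fin_words S"
    using fin_words_append by blast
  obtain q where q: "q \<in> core S (ter S (last (v @ w)))"
    using ex_core_point[OF fw vw(2)] by blast
  have "0 < deriv_norm (word_map S (v @ w)) q / distortion"
    using deriv_norm_word_map_pos[OF fw vw(2)] q core_nbhd[OF ter_last_in_verts[OF fw vw(2)]]
      distortion_ge_1 by (auto intro!: divide_pos_pos)
  then have "0 < (deriv_norm (word_map S (v @ w)) q / distortion) powr t * prob (cylinder S [b])"
    using b(2) by (metis mult_pos_pos powr_gt_zero less_irrefl)
  also have "\<dots> \<le> eigenvalue ^ length (v @ w) * prob (cylinder S ((v @ w) @ [b]))"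
    by (rule measure_cylinder_append_ge[OF vw _ q]) simp
  finally have "0 < prob (cylinder S ((v @ w) @ [b]))"
    using eigenvalue_pos by (simp add: zero_less_mult_iff)
  also have "\<dots> \<le> prob (cylinder S v)"
    using cylinder_append_subset[of S v "w @ [b]"] cylinder_sets
    by (intro finite_measure_mono) simp_all
  finally show ?thesis .
qed

end

section \<open>Almost every word contains a given word\<close>

context eigenmeasure_gdms
begin

text \<open>Inside every cylinder of length \<open>n\<close> the word \<open>w\<close> follows after a word of bounded length with
  conditional probability at least some \<open>q > 0\<close> independent of \<open>n\<close>; so the probability of avoiding
  \<open>w\<close> up to time \<open>n\<close> drops by the factor \<open>1 - q\<close> after each bounded time lapse.\<close>

lemma AE_contains_word:
  assumes irr: "finitely_irreducible S" and w: "w \<in> fin_words S" "w \<noteq> []"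
  shows "AE \<tau> in M. \<exists>n. map \<tau> [n..<n + length w] = w"
proof -
  obtain \<Lambda> where \<Lambda>: "finite \<Lambda>"
    "\<And>a b. a \<in> edges S \<Longrightarrow> b \<in> edges S \<Longrightarrow> \<exists>w\<in>\<Lambda>. [a] @ w @ [b] \<in> fin_words S"
    using irr unfolding finitely_irreducible_def by blast
  \<comment> \<open>Only links that can precede \<open>w\<close> are kept, so that all the cylinders
    entering \<open>\<theta>\<close> have positive measure.\<close>
  define \<Lambda>' where "\<Lambda>' = {v \<in> \<Lambda>. v @ w \<in> fin_words S}"
  have fin: "finite \<Lambda>'"
    using \<Lambda>(1) by (simp add: \<Lambda>'_def)
  have link: "\<exists>v\<in>\<Lambda>'. u @ v @ w \<in> fin_words S" if u: "u \<in> fin_words S" "u \<noteq> []" for u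
  proof -
    obtain v where v: "v \<in> \<Lambda>" "[last u] @ v @ [hd w] \<in> fin_words S"
      using \<Lambda>(2)[OF last_in_edges[OF u] hd_in_edges[OF w]] by blast
    then have "u @ v @ w \<in> fin_words S"
      using u w by (cases "v = []"; simp add: fin_words_append fin_words_Cons)+
    moreover from this have "v @ w \<in> fin_words S"
      using fin_words_append by blast
    ultimately show ?thesis
      using v(1) unfolding \<Lambda>'_def by blast
  qed
  define \<theta> where "\<theta> = Min (insert 1 ((\<lambda>v. prob (cylinder S (v @ w))) ` \<Lambda>'))"
  have "0 < prob (cylinder S (v @ w))" if "v \<in> \<Lambda>'" for v
    using that w by (intro measure_cylinder_pos[OF irr]) (auto simp: \<Lambda>'_def)
  then have \<theta>: "0 < \<theta>" "\<And>v. v \<in> \<Lambda>' \<Longrightarrow> \<theta> \<le> prob (cylinder S (v @ w))"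
    unfolding \<theta>_def using fin by auto
  define L where "L = Max (insert 0 (length ` \<Lambda>')) + length w"
  have L: "length v + length w \<le> L" if "v \<in> \<Lambda>'" for v
    unfolding L_def using fin that by simp
  define q where "q = (1 / distortion\<^sup>2) powr t * \<theta>"
  have "1 / distortion\<^sup>2 \<noteq> 0"
    using distortion_ge_1 by simp
  then have q0: "0 < q"
    unfolding q_def using \<theta>(1) powr_gt_zero mult_pos_pos by blast
  define Z where "Z n = {\<tau> \<in> inf_words S. \<not> (\<exists>k. k + length w \<le> n \<and> map \<tau> [k..<k + length w] = w)}"
    for n
  \<comment> \<open>Avoiding \<open>w\<close> within the first \<open>n\<close> letters is decided
    by the prefix, so \<open>Z n\<close> is the disjoint union of the cylinders over
    \<open>U n\<close>.\<close>
  define U where "U n = (\<lambda>\<tau>. map \<tau> [0..<n]) ` Z n" for n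
  have Z_UN: "Z n = (\<Union>u\<in>U n. cylinder S u)" for n
  proof (intro equalityI subsetI)
    fix \<tau> assume "\<tau> \<in> Z n"
    then show "\<tau> \<in> (\<Union>u\<in>U n. cylinder S u)"
      unfolding U_def using mem_cylinder_prefix[of \<tau> S n] by (auto simp: Z_def)
  next
    fix \<tau> assume "\<tau> \<in> (\<Union>u\<in>U n. cylinder S u)"
    then obtain \<sigma> where \<sigma>: "\<sigma> \<in> Z n" "\<tau> \<in> cylinder S (map \<sigma> [0..<n])"
      unfolding U_def by blast
    have "map \<tau> [k..<k + length w] = map \<sigma> [k..<k + length w]" if "k + length w \<le> n" for k
      using \<sigma>(2) that by (auto simp: cylinder_def)
    moreover have "\<tau> \<in> inf_words S"
      using \<sigma>(2) by (simp add: cylinder_def)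
    ultimately show "\<tau> \<in> Z n"
      using \<sigma>(1) unfolding Z_def mem_Collect_eq by metis
  qed
  have U_words: "u \<in> fin_words S" "length u = n" if "u \<in> U n" for u n
    using that prefix_in_fin_words unfolding U_def Z_def by auto
  have "U n \<subseteq> lists (edges S)" for n
    using U_words(1) by (auto simp: fin_words_def)
  then have U_countable: "countable (U n)" for n
    by (rule countable_subset) (rule countable_lists[OF countable_edges])
  have disj: "disjoint_family_on (cylinder S) (U n)" for n
    unfolding disjoint_family_on_def
  proof (intro ballI impI)
    fix u v assume uv: "u \<in> U n" "v \<in> U n" "u \<noteq> v"
    then have "length u = length v"
      using U_words(2)[OF uv(1)] U_words(2)[OF uv(2)] by simp
    then show "cylinder S u \<inter> cylinder S v = {}"
      using uv(3) by (metis Int_emptyI mem_cylinderD)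
  qed
  have Z_sets: "Z n \<in> sets M" for n
    unfolding Z_UN using U_countable cylinder_sets by (intro sets.countable_UN'') auto
  have Z_decr: "Z n \<subseteq> Z m" if "m \<le> n" for m n
    using that unfolding Z_def by auto
  have step: "prob (Z (n + L)) \<le> (1 - q) * prob (Z n)" if "0 < n" for n
  proof -
    have "\<exists>v. v \<in> \<Lambda>' \<and> u @ v @ w \<in> fin_words S" if u: "u \<in> U n" for u
    proof -
      have "u \<noteq> []"
        using U_words(2)[OF u] \<open>0 < n\<close> by auto
      then show ?thesis
        using link[OF U_words(1)[OF u]] by blast
    qed
    then obtain f where f: "\<And>u. u \<in> U n \<Longrightarrow> f u \<in> \<Lambda>'"
      "\<And>u. u \<in> U n \<Longrightarrow> u @ f u @ w \<in> fin_words S"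
      by metis
    \<comment> \<open>One subcylinder for each prefix; on it \<open>w\<close> occurs no later than
      time \<open>n + L\<close>, so it is disjoint from \<open>Z (n + L)\<close>.\<close>
    define V where "V u = cylinder S (u @ f u @ w)" for u
    have V_sub: "V u \<subseteq> cylinder S u" for u
      unfolding V_def by (rule cylinder_append_subset)
    have V_sets: "V u \<in> sets M" for u
      unfolding V_def by (rule cylinder_sets)
    have UV_sets: "(\<Union>u\<in>U n. V u) \<in> sets M"
      using U_countable V_sets by (intro sets.countable_UN'') auto
    have "disjoint_family_on V (U n)"
      using disj[of n] V_sub unfolding disjoint_family_on_def by blast
    then have "emeasure M (\<Union>u\<in>U n. V u) = (\<integral>\<^sup>+u. emeasure M (V u) \<partial>count_space (U n))"
      by (intro emeasure_UN_countable V_sets U_countable)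
    also have "\<dots> \<ge> (\<integral>\<^sup>+u. ennreal q * emeasure M (cylinder S u) \<partial>count_space (U n))"
    proof (rule nn_integral_mono)
      fix u assume "u \<in> space (count_space (U n))"
      then have u: "u \<in> U n"
        by simp
      have "q * prob (cylinder S u) = (1 / distortion\<^sup>2) powr t * prob (cylinder S u) * \<theta>"
        by (simp add: q_def)
      also have "\<dots> \<le>
          (1 / distortion\<^sup>2) powr t * prob (cylinder S u) * prob (cylinder S (f u @ w))"
        using \<theta>(2)[OF f(1)[OF u]] by (intro mult_left_mono) auto
      also have "\<dots> \<le> prob (V u)"
        unfolding V_def using U_words[OF u] that w(2)
        by (intro measure_cylinder_supermultiplicative f(2) u) auto
      finally show "ennreal q * emeasure M (cylinder S u) \<le> emeasure M (V u)"
        unfolding emeasure_eq_measure using q0 by (simp add: ennreal_mult[symmetric] ennreal_leI)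
    qed
    also have "(\<integral>\<^sup>+u. ennreal q * emeasure M (cylinder S u) \<partial>count_space (U n)) =
        ennreal q * emeasure M (Z n)"
      unfolding Z_UN
      by (subst emeasure_UN_countable[OF cylinder_sets U_countable disj])
        (simp add: nn_integral_cmult)
    finally have "ennreal q * emeasure M (Z n) \<le> emeasure M (\<Union>u\<in>U n. V u)" .
    then have "q * prob (Z n) \<le> prob (\<Union>u\<in>U n. V u)"
      unfolding emeasure_eq_measure using q0 by (simp add: ennreal_mult[symmetric])
    moreover have "prob (\<Union>u\<in>U n. V u) + prob (Z (n + L)) = prob ((\<Union>u\<in>U n. V u) \<union> Z (n + L))"
    proof (rule finite_measure_Union[OF UV_sets Z_sets, symmetric])
      have "\<tau> \<notin> Z (n + L)" if u: "u \<in> U n" and \<tau>: "\<tau> \<in> V u" for \<tau> u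
      proof -
        let ?k = "n + length (f u)"
        have "map \<tau> [?k..<?k + length w] = w"
          using \<tau> U_words(2)[OF u] unfolding V_def cylinder_def
          by (intro nth_equalityI) (auto simp: nth_append)
        moreover have "?k + length w \<le> n + L"
          using L[OF f(1)[OF u]] by simp
        ultimately show ?thesis
          unfolding Z_def by blast
      qed
      then show "(\<Union>u\<in>U n. V u) \<inter> Z (n + L) = {}"
        by blast
    qed
    moreover have "prob ((\<Union>u\<in>U n. V u) \<union> Z (n + L)) \<le> prob (Z n)"
    proof (rule finite_measure_mono[OF _ Z_sets])
      show "(\<Union>u\<in>U n. V u) \<union> Z (n + L) \<subseteq> Z n"
        using V_sub Z_decr[of n "n + L"] unfolding Z_UN[of n] by (auto simp: Z_UN[of "n + L"])
    qed
    ultimately show ?thesis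
      by (simp add: algebra_simps)
  qed
  have lim: "(\<lambda>n. prob (Z n)) \<longlonglongrightarrow> prob (\<Inter>n. Z n)"
    using Z_sets Z_decr by (intro finite_Lim_measure_decseq) (auto simp: decseq_def)
  \<comment> \<open>The limit of the decreasing probabilities is bounded by \<open>1 - q\<close>
    times itself, so it vanishes.\<close>
  have "prob (\<Inter>n. Z n) \<le> (1 - q) * prob (\<Inter>n. Z n)"
  proof (rule LIMSEQ_le)
    show "(\<lambda>n. prob (Z (n + L))) \<longlonglongrightarrow> prob (\<Inter>n. Z n)"
      by (rule LIMSEQ_ignore_initial_segment[OF lim])
    show "(\<lambda>n. (1 - q) * prob (Z n)) \<longlonglongrightarrow> (1 - q) * prob (\<Inter>n. Z n)"
      by (intro tendsto_mult tendsto_const lim)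
    show "\<exists>N. \<forall>n\<ge>N. prob (Z (n + L)) \<le> (1 - q) * prob (Z n)"
      using step by (intro exI[of _ 1]) auto
  qed
  then have "q * prob (\<Inter>n. Z n) \<le> 0"
    by (simp add: algebra_simps)
  then have "prob (\<Inter>n. Z n) = 0"
    using q0 by (simp add: mult_le_0_iff measure_le_0_iff)
  moreover have "(\<Inter>n. Z n) \<in> sets M"
    using Z_sets by blast
  ultimately have "(\<Inter>n. Z n) \<in> null_sets M"
    by (intro null_setsI) (simp_all add: emeasure_eq_measure)
  then show ?thesis
  proof (rule AE_I')
    show "{\<tau> \<in> space M. \<not> (\<exists>n. map \<tau> [n..<n + length w] = w)} \<subseteq> (\<Inter>n. Z n)"
      unfolding Z_def space_M by blast
  qed
qed

text \<open>Countably many values \<open>1 / Suc k\<close> suffice: once one lies below both the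
  porosity constant and its threshold, the dense ball at that scale leaves no room for the promised
  hole.\<close>

lemma AE_not_porous_at_coding:
  assumes irr: "finitely_irreducible S" and np: "\<not> uniformly_porous (limit_set S)"
  shows "AE \<tau> in M. \<not> porous_at (limit_set S) (coding S \<tau>)"
proof -
  let ?dense = "\<lambda>\<tau> \<epsilon>. \<exists>r. 0 < r \<and> r < \<epsilon> \<and>
    (\<forall>y. ball y (\<epsilon> * r) \<subseteq> ball (coding S \<tau>) r \<longrightarrow> ball y (\<epsilon> * r) \<inter> limit_set S \<noteq> {})"
  have "AE \<tau> in M. ?dense \<tau> (1 / real (Suc k))" for k
  proof -
    have "0 < 1 / real (Suc k)" "1 / real (Suc k) \<le> 1"
      by auto
    from ex_word_dense[OF irr np this]
    obtain w where w: "w \<in> fin_words S" "w \<noteq> []"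
      "\<And>\<tau> n. \<tau> \<in> inf_words S \<Longrightarrow> map \<tau> [n..<n + length w] = w \<Longrightarrow> ?dense \<tau> (1 / real (Suc k))"
      by blast
    have "AE \<tau> in M. \<tau> \<in> inf_words S"
      using AE_space[of M] unfolding space_M .
    with AE_contains_word[OF irr w(1,2)] show ?thesis
      by eventually_elim (use w(3) in blast)
  qed
  then have "AE \<tau> in M. \<forall>k. ?dense \<tau> (1 / real (Suc k))"
    unfolding AE_all_countable by blast
  then show ?thesis
  proof eventually_elim
    case (elim \<tau>)
    show ?case
    proof
      assume "porous_at (limit_set S) (coding S \<tau>)"
      then obtain c r0 where c: "0 < c" "0 < r0"
        and b: "\<And>r. 0 < r \<Longrightarrow> r < r0 \<Longrightarrow>
            \<exists>y. ball y (c * r) \<subseteq> ball (coding S \<tau>) r - limit_set S"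
        unfolding porous_at_iff by blast
      obtain k where "inverse (real (Suc k)) < min c r0"
        using reals_Archimedean[of "min c r0"] c by auto
      then have k: "1 / Suc k < c" "1 / Suc k < r0"
        by (auto simp: inverse_eq_divide)
      obtain r where r: "0 < r" "r < 1 / Suc k"
        and d: "\<And>y. ball y (1 / Suc k * r) \<subseteq> ball (coding S \<tau>) r \<Longrightarrow>
            ball y (1 / Suc k * r) \<inter> limit_set S \<noteq> {}"
        using elim by blast
      obtain y where y: "ball y (c * r) \<subseteq> ball (coding S \<tau>) r - limit_set S"
        using b[of r] r k by auto
      have "1 / Suc k * r \<le> c * r"
        using k r by (intro mult_right_mono) auto
      then have "ball y (1 / Suc k * r) \<subseteq> ball y (c * r)"
        by (rule subset_ball)
      then show False
        using d[of y] y by blast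
    qed
  qed
qed

end

theorem theorem1p4:
  fixes S :: "('v, 'e, real ^ 'n) conformal_gdms_data"
    and h :: real
    and m :: "(real ^ 'n) measure"
  assumes "conformal_gdms S"
    and "finitely_irreducible S"
    and "\<not> porous (limit_set S) \<or> (\<exists>\<zeta>\<in>closure (limit_set S). \<not> porous_at (limit_set S) \<zeta>)"
    and "h = hausdorff_dim (limit_set S)"
    and "conformal_measure S h m"
  shows "AE x in m. x \<in> limit_set S \<longrightarrow> \<not> porous_at (limit_set S) x"
proof -
  obtain M where M: "eigenmeasure S h M" "m = distr M borel (coding S)"
    using assms(5) unfolding conformal_measure_def by blast
  interpret conformal_gdms S
    by fact
  interpret eigenmeasure_gdms S h M
    by unfold_locales (rule M(1))
  have "\<not> uniformly_porous (limit_set S)"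
    using assms(3) porous_if_uniformly_porous porous_at_if_uniformly_porous by blast
  then have "AE \<tau> in M. \<not> porous_at (limit_set S) (coding S \<tau>)"
    by (rule AE_not_porous_at_coding[OF assms(2)])
  moreover have "coding S \<in> M \<rightarrow>\<^sub>M borel"
    by (rule borel_measurable_word_continuous[OF coding_word_continuous space_M sets_M])
  \<comment> \<open>Measurability of the exceptional set is what transfers the statement from words
    to the image measure.\<close>
  moreover have "{x \<in> space borel. \<not> porous_at (limit_set S) x} \<in> sets borel"
  proof -
    have "{x \<in> space borel. \<not> porous_at (limit_set S) x} = - {x. porous_at (limit_set S) x}"
      by auto
    then show ?thesis
      using borel_porous_at[of "limit_set S"] by (simp only: borel_comp)
  qed
  ultimately have "AE x in m. \<not> porous_at (limit_set S) x"
    unfolding M(2) by (subst AE_distr_iff)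
  then show ?thesis
    by eventually_elim simp
qed

end
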